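(* Let $\mathbf{X}=(X_1,\dots,X_d)$ be a random vector with independent components with pdfs $f_1,\dots,f_d$ and joint pdf $f(\mathbf{x})=\prod_{j=1}^d f_j(x_j)$, let $G:\mathbb{R}^d\to\mathbb{R}$ be measurable, let $i\in\{1,\dots,d\}$, and let $f_{i\delta}$ be a pdf on $\mathbb{R}$. Let $$P=\int \mathbf{1}_{\{G(\mathbf{x})<0\}}f(\mathbf{x})\,d\mathbf{x},\qquad P_{i\delta}=\int \mathbf{1}_{\{G(\mathbf{x})<0\}}\frac{f_{i\delta}(x_i)}{f_i(x_i)}f(\mathbf{x})\,d\mathbf{x}.$$ Let $\mathbf{x}^1,\mathbf{x}^2,\dots$ be independent copies of $\mathbf{X}$ and $$\hat P_N=\frac1N\sum_{n=1}^N\mathbf{1}_{\{G(\mathbf{x}^n)<0\}},\qquad \hat P_{i\delta N}=\frac1N\sum_{n=1}^N\mathbf{1}_{\{G(\mathbf{x}^n)<0\}}\frac{f_{i\delta}(x_i^n)}{f_i(x_i^n)}.$$ Assume (i) $\mathrm{Supp}(f_{i\delta})\subseteq\mathrm{Supp}(f_i)$, (ii) $\displaystyle\int_{\mathrm{Supp}(f_i)}\frac{f_{i\delta}^2(x)}{f_i(x)}\,dx<\infty$. Then $$\sqrt N\left[\begin{pmatrix}\hat P_N\\ \hat P_{i\delta N}\end{pmatrix}-\begin{pmatrix}P\\ P_{i\delta}\end{pmatrix}\right]\xrightarrow[N\to\infty]{\mathcal{L}}\mathcal{N}_2(0,\Sigma_{i\delta}),\qquad \Sigma_{i\delta}=\begin{pmatrix}P(1-P)&P_{i\delta}(1-P)\\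 P_{i\delta}(1-P)&\sigma_{i\delta}^2\end{pmatrix},$$ where $\sigma_{i\delta}^2=\mathrm{Var}\left[\mathbf{1}_{\{G(\mathbf{X})<0\}}\frac{f_{i\delta}(X_i)}{f_i(X_i)}\right]$. Moreover $\Sigma_{i\delta}$ is consistently estimated by $$\hat\Sigma_{i\delta}=\begin{pmatrix}\hat P_N(1-\hat P_N)&\hat P_{i\delta N}(1-\hat P_N)\\ \hat P_{i\delta N}(1-\hat P_N)&\hat\sigma_{i\delta N}^2\end{pmatrix},\qquad \hat\sigma^2_{i\delta N}=\frac1N\sum_{n=1}^N\mathbf{1}_{\{G(\mathbf{x}^n)<0\}}\left(\frac{f_{i\delta}(x_i^n)}{f_i(x_i^n)}\right)^2-\hat P_{i\delta N}^2 .$$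
   Context: $x_i^n$ denotes the $i$-th component of $\mathbf{x}^n$. $\mathrm{Supp}(g)$ denotes the set $\{x: g(x)>0\}$ where the density $g$ is positive, so the ratio $f_{i\delta}(x_i)/f_i(x_i)$ is considered only where $f_i(x_i)>0$. $\xrightarrow{\mathcal{L}}$ denotes convergence in distribution; a normal law with singular covariance is understood as the corresponding degenerate Gaussian. "Consistently estimated" means that the estimator converges in probability to the target as $N\to\infty$. *)

theory Defs
  imports "HOL-Probability.Probability"
begin

definition is_pdf :: "(real \<Rightarrow> real) \<Rightarrow> bool" where
  "is_pdf g \<longleftrightarrow> g \<in> borel_measurable borel \<and> (\<forall>t. 0 \<le> g t) \<and>
     (\<integral>\<^sup>+ t. ennreal (g t) \<partial>lborel) = 1"

definition Supp :: "(real \<Rightarrow> real) \<Rightarrow> real set" where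
  "Supp g = {t. g t > 0}"

definition joint_pdf :: "('d::finite \<Rightarrow> real \<Rightarrow> real) \<Rightarrow> real ^ 'd \<Rightarrow> real" where
  "joint_pdf f y = (\<Prod>j\<in>UNIV. f j (y $ j))"

definition failure :: "(real ^ 'd::finite \<Rightarrow> real) \<Rightarrow> real ^ 'd \<Rightarrow> real" where
  "failure G = indicator {y. G y < 0}"

text \<open>Where \<open>f i\<close> vanishes the quotient is 0 by the convention on division by zero. This is
  immaterial: a random variable with density \<open>f i\<close> almost surely takes values in \<open>Supp (f i)\<close>.\<close>

definition lik_ratio :: "(real \<Rightarrow> real) \<Rightarrow> (real \<Rightarrow> real) \<Rightarrow> real \<Rightarrow> real" where
  "lik_ratio f\<delta> g t = f\<delta> t / g t"

definition P_fail :: "('d::finite \<Rightarrow> real \<Rightarrow> real) \<Rightarrow> (real ^ 'd \<Rightarrow> real) \<Rightarrow> real" where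
  "P_fail f G = (\<integral>y. failure G y * joint_pdf f y \<partial>lborel)"

definition P_pert ::
  "('d::finite \<Rightarrow> real \<Rightarrow> real) \<Rightarrow> (real ^ 'd \<Rightarrow> real) \<Rightarrow> 'd \<Rightarrow> (real \<Rightarrow> real) \<Rightarrow> real" where
  "P_pert f G i f\<delta> =
     (\<integral>y. failure G y * lik_ratio f\<delta> (f i) (y $ i) * joint_pdf f y \<partial>lborel)"

definition P_hat ::
  "(real ^ 'd::finite \<Rightarrow> real) \<Rightarrow> (nat \<Rightarrow> 'a \<Rightarrow> real ^ 'd) \<Rightarrow> nat \<Rightarrow> 'a \<Rightarrow> real" where
  "P_hat G x N \<omega> = 1 / real N * (\<Sum>n=1..N. failure G (x n \<omega>))"

definition P_pert_hat ::
  "('d::finite \<Rightarrow> real \<Rightarrow> real) \<Rightarrow> (real ^ 'd \<Rightarrow> real) \<Rightarrow> 'd \<Rightarrow> (real \<Rightarrow> real) \<Rightarrow>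
   (nat \<Rightarrow> 'a \<Rightarrow> real ^ 'd) \<Rightarrow> nat \<Rightarrow> 'a \<Rightarrow> real" where
  "P_pert_hat f G i f\<delta> x N \<omega> =
     1 / real N * (\<Sum>n=1..N. failure G (x n \<omega>) * lik_ratio f\<delta> (f i) (x n \<omega> $ i))"

definition sigma2_hat ::
  "('d::finite \<Rightarrow> real \<Rightarrow> real) \<Rightarrow> (real ^ 'd \<Rightarrow> real) \<Rightarrow> 'd \<Rightarrow> (real \<Rightarrow> real) \<Rightarrow>
   (nat \<Rightarrow> 'a \<Rightarrow> real ^ 'd) \<Rightarrow> nat \<Rightarrow> 'a \<Rightarrow> real" where
  "sigma2_hat f G i f\<delta> x N \<omega> =
     1 / real N * (\<Sum>n=1..N. failure G (x n \<omega>) * (lik_ratio f\<delta> (f i) (x n \<omega> $ i))\<^sup>2)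
     - (P_pert_hat f G i f\<delta> x N \<omega>)\<^sup>2"

definition cov_matrix :: "real \<Rightarrow> real \<Rightarrow> real \<Rightarrow> real ^ 2 ^ 2" where
  "cov_matrix p q s =
     vector [vector [p * (1 - p), q * (1 - p)],
             vector [q * (1 - p), s]]"

definition std_multi_normal :: "(real ^ 'n::finite) measure" where
  "std_multi_normal = density lborel (\<lambda>z. ennreal (\<Prod>k\<in>UNIV. std_normal_density (z $ k)))"

text \<open>\<open>L\<close> is the law of \<open>m + A Z\<close> with \<open>Z\<close> standard Gaussian and \<open>A A\<^sup>T = S\<close>. The law does
  not depend on the choice of \<open>A\<close>, and singular \<open>S\<close> (degenerate Gaussians) are included.\<close>

definition is_multi_normal ::
  "(real ^ 'n::finite) measure \<Rightarrow> real ^ 'n \<Rightarrow> real ^ 'n ^ 'n \<Rightarrow> bool" where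
  "is_multi_normal L m S \<longleftrightarrow>
     (\<exists>A :: real ^ 'n ^ 'n. A ** transpose A = S \<and>
        L = distr std_multi_normal borel (\<lambda>z. m + A *v z))"

definition conv_in_law ::
  "'a measure \<Rightarrow> (nat \<Rightarrow> 'a \<Rightarrow> 'b::topological_space) \<Rightarrow> 'b measure \<Rightarrow> bool" where
  "conv_in_law M Y L \<longleftrightarrow>
     (\<forall>n. Y n \<in> borel_measurable M) \<and> prob_space L \<and> sets L = sets borel \<and>
     (\<forall>g :: 'b \<Rightarrow> real. continuous_on UNIV g \<and> bounded (range g) \<longrightarrow>
        (\<lambda>n. \<integral>\<omega>. g (Y n \<omega>) \<partial>M) \<longlonglongrightarrow> (\<integral>y. g y \<partial>L))"

definition conv_in_prob ::
  "'a measure \<Rightarrow> (nat \<Rightarrow> 'a \<Rightarrow> 'b::metric_space) \<Rightarrow> 'b \<Rightarrow> bool" where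
  "conv_in_prob M Y c \<longleftrightarrow>
     (\<forall>n. Y n \<in> borel_measurable M) \<and>
     (\<forall>\<epsilon>>0. (\<lambda>n. measure M {\<omega> \<in> space M. dist (Y n \<omega>) c > \<epsilon>}) \<longlonglongrightarrow> 0)"

end

theory Submission
  imports Defs
begin

text \<open>The pair \<open>(1\<^sub>F, 1\<^sub>F r)\<close> of failure indicator and weighted indicator, with \<open>r = f\<^sub>i\<^sub>\<delta> / f\<^sub>i\<close>, has finite
  second moments by assumption (ii), and the estimators are its empirical means. Every linear
  functional of the normalized empirical mean satisfies the one-dimensional central limit theorem,
  so its characteristic function converges to the Gaussian one. Second moments being bounded, this
  gives weak convergence: a bounded continuous function agrees on a large ball with a function that
  is a uniform limit of trigonometric polynomials. Since \<open>1\<^sub>F\<^sup>2 = 1\<^sub>F\<close>, the covariance matrix is the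
  stated one, and it has a Cholesky factor, possibly singular. Consistency follows from the weak law
  of large numbers for \<open>1\<^sub>F\<close>, \<open>1\<^sub>F r\<close> and \<open>1\<^sub>F r\<^sup>2\<close> and from continuity.\<close>

subsection \<open>Weak convergence from characteristic functions\<close>

text \<open>Finite sums of waves with complex coefficients. A statement that is linear in the
  function then only has to be checked on a single wave.\<close>

inductive trig_poly :: "('b::real_inner \<Rightarrow> complex) \<Rightarrow> bool" where
  wave: "trig_poly (\<lambda>y. c * iexp (t \<bullet> y))"
| add: "trig_poly u \<Longrightarrow> trig_poly v \<Longrightarrow> trig_poly (\<lambda>y. u y + v y)"

text \<open>Two waves multiply to one wave whose frequency is the sum. This is the case of a single
  wave in one factor; a second induction gives closure under all products.\<close>

lemma trig_poly_wave_mult: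
  assumes "trig_poly u"
  shows "trig_poly (\<lambda>y. c * iexp (t \<bullet> y) * u y)"
  using assms
proof induction
  case (wave d s)
  have "(\<lambda>y. c * iexp (t \<bullet> y) * (d * iexp (s \<bullet> y))) = (\<lambda>y. (c * d) * iexp ((t + s) \<bullet> y))"
    by (auto simp: inner_add_left exp_add algebra_simps)
  then show ?case by (simp only: trig_poly.wave)
next
  case (add u v)
  then show ?case using trig_poly.add[of "\<lambda>y. c * iexp (t \<bullet> y) * u y"] by (simp add: distrib_left)
qed

lemma trig_poly_mult:
  assumes "trig_poly u" "trig_poly v"
  shows "trig_poly (\<lambda>y. u y * v y)"
  using assms(1)
proof induction
  case (wave d s)
  then show ?case by (rule trig_poly_wave_mult[OF assms(2)])
next
  case (add u w)
  then show ?case using trig_poly.add by (simp add: distrib_right)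
qed

lemma trig_poly_const: "trig_poly (\<lambda>_. c)"
  using trig_poly.wave[of c 0] by simp

lemma trig_poly_sum:
  assumes "finite S" "\<And>k. k \<in> S \<Longrightarrow> trig_poly (u k)"
  shows "trig_poly (\<lambda>y. \<Sum>k\<in>S. u k y)"
  using assms by (induction S) (auto intro: trig_poly_const trig_poly.add)

text \<open>Euler's formula writes the sine as a combination of the waves of frequency
  \<open>t\<close> and \<open>- t\<close>.\<close>

lemma trig_poly_sin: "trig_poly (\<lambda>y. complex_of_real (sin (t \<bullet> y)))"
proof -
  have "(\<lambda>y. complex_of_real (sin (t \<bullet> y))) =
    (\<lambda>y. (- \<i> / 2) * iexp (t \<bullet> y) + (\<i> / 2) * iexp ((- t) \<bullet> y))"
    by (rule ext) (simp add: complex_eq_iff Re_exp Im_exp)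
  then show ?thesis
    by (simp only:) (intro trig_poly.intros)
qed

text \<open>Each coordinate \<open>sin (a * y $ k)\<close> is a trigonometric polynomial, a linear
  form is a combination of coordinates, and sums and products stay in the class. This turns a
  Stone--Weierstrass polynomial in the sines into a sum of waves.\<close>

lemma trig_poly_real_polynomial_sin:
  fixes p :: "real ^ 'n \<Rightarrow> real"
  assumes "real_polynomial_function p"
  shows "trig_poly (\<lambda>y. complex_of_real (p (\<chi> k. sin (a * y $ k))))"
  using assms
proof induction
  case (linear h)
  have "h (\<chi> k. s k) = (\<Sum>k\<in>UNIV. s k * h (axis k 1))" for s :: "'n \<Rightarrow> real"
  proof -
    have "(\<chi> k. s k) = (\<Sum>k\<in>UNIV. s k *\<^sub>R axis k 1)"
      by (simp add: vec_eq_iff axis_def if_distrib cong: if_cong)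
    then show ?thesis
      using linear by (simp add: bounded_linear.linear linear_sum linear_scale)
  qed
  then have "(\<lambda>y. complex_of_real (h (\<chi> k. sin (a * y $ k)))) =
     (\<lambda>y. \<Sum>k\<in>UNIV. complex_of_real (sin ((a *\<^sub>R axis k 1) \<bullet> y)) * complex_of_real (h (axis k 1)))"
    by (simp add: inner_axis')
  then show ?case
    by (simp only:) (intro trig_poly_sum trig_poly_mult trig_poly_sin trig_poly_const finite)
qed (auto intro: trig_poly.add trig_poly_mult trig_poly_const)

lemma trig_poly_integrable:
  fixes Y :: "'a \<Rightarrow> 'b::euclidean_space"
  assumes "prob_space M" "Y \<in> borel_measurable M" "trig_poly u"
  shows "integrable M (\<lambda>\<omega>. u (Y \<omega>))"
  using assms(3)
proof induction
  case (wave c t)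
  interpret prob_space M by fact
  note [measurable] = assms(2)
  have "integrable M (\<lambda>\<omega>. iexp (t \<bullet> Y \<omega>))"
    by (intro integrable_const_bound[of _ 1]) auto
  then show ?case by simp
qed simp

text \<open>Expectations of waves are values of characteristic functions up to a factor, so
  \<open>char\<close> is the base case and linearity of the integral gives the rest.\<close>

lemma trig_poly_expectation_tendsto:
  fixes Y :: "nat \<Rightarrow> 'a \<Rightarrow> 'b::euclidean_space"
  assumes M: "prob_space M" and L: "prob_space L" "sets L = sets borel"
    and Y: "\<And>n. Y n \<in> borel_measurable M"
    and char: "\<And>t. (\<lambda>n. \<integral>\<omega>. iexp (t \<bullet> Y n \<omega>) \<partial>M) \<longlonglongrightarrow> (\<integral>y. iexp (t \<bullet> y) \<partial>L)"
    and u: "trig_poly u"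
  shows "(\<lambda>n. \<integral>\<omega>. u (Y n \<omega>) \<partial>M) \<longlonglongrightarrow> (\<integral>y. u y \<partial>L)"
  using u
proof induction
  case (wave c t)
  then show ?case using tendsto_mult_left[OF char[of t], of c] by simp
next
  case (add u v)
  have id: "(\<lambda>y. y) \<in> borel_measurable L" using L by simp
  show ?case
    using tendsto_add[OF add.IH] trig_poly_integrable[OF M Y add.hyps(1)]
      trig_poly_integrable[OF M Y add.hyps(2)] trig_poly_integrable[OF L(1) id add.hyps(1)]
      trig_poly_integrable[OF L(1) id add.hyps(2)]
    by simp
qed

text \<open>\<open>fold_box K\<close> is the identity on the ball of radius \<open>K\<close>, and \<open>g \<circ> fold_box K\<close> is a continuous
  function of the bounded vector \<open>sin (y $ k / K)\<close>. Stone--Weierstrass therefore approximates it by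
  trigonometric polynomials uniformly on the whole space, not just on a compact set.\<close>

definition fold_box :: "real \<Rightarrow> real ^ 'n \<Rightarrow> real ^ 'n" where
  "fold_box K y = (\<chi> k. K * arcsin (sin (y $ k / K)))"

text \<open>The coordinates of \<open>y\<close> divided by \<open>K\<close> lie in [-1, 1], inside
  the interval [-pi/2, pi/2] on which \<open>arcsin\<close> inverts \<open>sin\<close>.\<close>

lemma fold_box_id:
  assumes "norm y \<le> K" "0 < K"
  shows "fold_box K y = y"
proof -
  have "K * arcsin (sin (y $ k / K)) = y $ k" for k
  proof -
    have "\<bar>y $ k\<bar> \<le> K" using component_le_norm_cart[of y k] assms by linarith
    then have "\<bar>y $ k / K\<bar> \<le> 1" using assms by simp
    then have "- (pi / 2) \<le> y $ k / K" "y $ k / K \<le> pi / 2" using pi_gt3 by linarith+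
    then show ?thesis using assms by (simp add: arcsin_sin)
  qed
  then show ?thesis by (simp add: fold_box_def vec_eq_iff)
qed

lemma continuous_on_fold_box: "0 < K \<Longrightarrow> continuous_on UNIV (fold_box K)"
  unfolding fold_box_def by (intro continuous_intros) auto

text \<open>An approximation that is uniform within \<open>r / 4\<close> changes the expectations
  under \<open>M\<close> and under \<open>L\<close> by at most \<open>r / 4\<close> each, for every
  \<open>n\<close>, and the expectations of the approximant converge. The three errors sum to less
  than \<open>r\<close>.\<close>

lemma expectation_fold_box_tendsto:
  fixes Y :: "nat \<Rightarrow> 'a \<Rightarrow> real ^ 'n::finite" and g :: "real ^ 'n \<Rightarrow> real"
  assumes M: "prob_space M" and L: "prob_space L" "sets L = sets borel"
    and Y: "\<And>n. Y n \<in> borel_measurable M"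
    and char: "\<And>t. (\<lambda>n. \<integral>\<omega>. iexp (t \<bullet> Y n \<omega>) \<partial>M) \<longlonglongrightarrow> (\<integral>y. iexp (t \<bullet> y) \<partial>L)"
    and g: "continuous_on UNIV g" "\<And>y. \<bar>g y\<bar> \<le> B" and K: "0 < K"
  shows "(\<lambda>n. \<integral>\<omega>. g (fold_box K (Y n \<omega>)) \<partial>M) \<longlonglongrightarrow> (\<integral>y. g (fold_box K y) \<partial>L)"
proof (rule LIMSEQ_I)
  fix r :: real assume r: "0 < r"
  interpret M: prob_space M by fact
  interpret L: prob_space L by fact
  note [measurable] = Y
  have [measurable]: "(\<lambda>y. g (fold_box K y)) \<in> borel_measurable borel"
    using K by (intro borel_measurable_continuous_onI continuous_on_compose2[OF g(1)] continuous_on_fold_box) auto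
  have [measurable]: "(\<lambda>y. g (fold_box K y)) \<in> borel_measurable L"
    using L(2) by (simp cong: measurable_cong_sets)
  define s where "s y = (\<chi> k. sin (1 / K * y $ k))" for y :: "real ^ 'n"
  let ?S = "cbox (\<chi> k. -1) (\<chi> k. 1) :: (real ^ 'n) set"
  have sS: "s y \<in> ?S" for y by (auto simp: s_def mem_box_cart)
  \<comment> \<open>\<open>arcsin\<close> is continuous on [-1, 1], which is where the cube keeps
    each coordinate.\<close>
  have "continuous_on ?S (\<lambda>z. g (\<chi> k. K * arcsin (z $ k)))"
    by (intro continuous_on_compose2[OF g(1)] continuous_intros) (auto simp: mem_box_cart)
  then obtain p where p: "real_polynomial_function p"
      and "\<And>z. z \<in> ?S \<Longrightarrow> \<bar>g (\<chi> k. K * arcsin (z $ k)) - p z\<bar> < r / 4"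
    using Stone_Weierstrass_real_polynomial_function[of ?S _ "r / 4"] r compact_cbox
    by (metis divide_pos_pos zero_less_numeral)
  from this(2)[OF sS] have close: "\<bar>g (fold_box K y) - p (s y)\<bar> \<le> r / 4" for y
    by (simp add: s_def fold_box_def less_imp_le)
  define u where "u y = complex_of_real (p (s y))" for y
  have u: "trig_poly u"
    unfolding u_def s_def by (rule trig_poly_real_polynomial_sin[OF p])
  have id: "(\<lambda>y. y) \<in> borel_measurable L" using L by simp
  have intM: "integrable M (\<lambda>\<omega>. p (s (Y n \<omega>)))" for n
    using trig_poly_integrable[OF M Y u, of n] by (simp add: u_def complex_of_real_integrable_eq)
  have intL: "integrable L (\<lambda>y. p (s y))"
    using trig_poly_integrable[OF L(1) id u] by (simp add: u_def complex_of_real_integrable_eq)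
  have "(\<lambda>n. \<integral>\<omega>. p (s (Y n \<omega>)) \<partial>M) \<longlonglongrightarrow> (\<integral>y. p (s y) \<partial>L)"
    using trig_poly_expectation_tendsto[OF M L Y char u] unfolding u_def
    by (simp add: tendsto_of_real_iff)
  from LIMSEQ_D[OF this, of "r / 4"] r obtain n0 where
    n0: "\<And>n. n \<ge> n0 \<Longrightarrow> \<bar>(\<integral>\<omega>. p (s (Y n \<omega>)) \<partial>M) - (\<integral>y. p (s y) \<partial>L)\<bar> < r / 4"
    by auto
  have gM: "integrable M (\<lambda>\<omega>. g (fold_box K (Y n \<omega>)))" for n
    by (intro M.integrable_const_bound[of _ B]) (auto simp: g(2))
  have gL: "integrable L (\<lambda>y. g (fold_box K y))"
    by (intro L.integrable_const_bound[of _ B]) (auto simp: g(2))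
  have dM: "\<bar>(\<integral>\<omega>. g (fold_box K (Y n \<omega>)) \<partial>M) - (\<integral>\<omega>. p (s (Y n \<omega>)) \<partial>M)\<bar> \<le> r / 4" for n
  proof -
    have "\<bar>\<integral>\<omega>. g (fold_box K (Y n \<omega>)) - p (s (Y n \<omega>)) \<partial>M\<bar> \<le> (\<integral>\<omega>. r / 4 \<partial>M)"
      by (rule order_trans[OF integral_abs_bound integral_mono])
        (use close gM intM in \<open>auto\<close>)
    then show ?thesis using gM intM by (simp add: M.prob_space)
  qed
  have dL: "\<bar>(\<integral>y. g (fold_box K y) \<partial>L) - (\<integral>y. p (s y) \<partial>L)\<bar> \<le> r / 4"
  proof -
    have "\<bar>\<integral>y. g (fold_box K y) - p (s y) \<partial>L\<bar> \<le> (\<integral>y. r / 4 \<partial>L)"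
      by (rule order_trans[OF integral_abs_bound integral_mono])
        (use close gL intL in \<open>auto\<close>)
    then show ?thesis using gL intL by (simp add: L.prob_space)
  qed
  have "norm ((\<integral>\<omega>. g (fold_box K (Y n \<omega>)) \<partial>M) - (\<integral>y. g (fold_box K y) \<partial>L)) < r"
    if "n \<ge> n0" for n
    using n0[OF that] dM[of n] dL unfolding real_norm_def by linarith
  then show "\<exists>n0. \<forall>n\<ge>n0. norm ((\<integral>\<omega>. g (fold_box K (Y n \<omega>)) \<partial>M) - (\<integral>y. g (fold_box K y) \<partial>L)) < r"
    by blast
qed

text \<open>The bound \<open>C\<close> supplies tightness: replacing \<open>g\<close> by its folded
  version costs at most \<open>2 * B * C / K\<^sup>2\<close> under \<open>M\<close>, uniformly in
  \<open>n\<close>. Under \<open>L\<close> the cost tends to 0 by dominated convergence. For one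
  large radius both are below \<open>r / 3\<close>, and the expectations of the folded function
  converge.\<close>

theorem levy_continuity_bounded_second_moments:
  fixes Y :: "nat \<Rightarrow> 'a \<Rightarrow> real ^ 'n::finite"
  assumes M: "prob_space M" and L: "prob_space L" "sets L = sets borel"
    and Y: "\<And>n. Y n \<in> borel_measurable M"
    and char: "\<And>t. (\<lambda>n. \<integral>\<omega>. iexp (t \<bullet> Y n \<omega>) \<partial>M) \<longlonglongrightarrow> (\<integral>y. iexp (t \<bullet> y) \<partial>L)"
    and sq: "\<And>n. integrable M (\<lambda>\<omega>. (norm (Y n \<omega>))\<^sup>2)" "\<And>n. (\<integral>\<omega>. (norm (Y n \<omega>))\<^sup>2 \<partial>M) \<le> C"
  shows "conv_in_law M Y L"
  unfolding conv_in_law_def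
proof (intro conjI allI impI L Y)
  fix g :: "real ^ 'n \<Rightarrow> real"
  assume "continuous_on UNIV g \<and> bounded (range g)"
  then obtain B where g: "continuous_on UNIV g" "\<And>y. \<bar>g y\<bar> \<le> B"
    by (auto simp: bounded_iff)
  have B: "0 \<le> B" using g(2)[of 0] by linarith
  interpret M: prob_space M by fact
  interpret L: prob_space L by fact
  note [measurable] = Y
  have [measurable]: "g \<in> borel_measurable borel"
    using g(1) by (rule borel_measurable_continuous_onI)
  \<comment> \<open>The dominated convergence below runs over the radii \<open>real m\<close> from
    \<open>m = 0\<close> on, so \<open>K = 0\<close> is covered too; there the folding is constantly
    0.\<close>
  have [measurable]: "(fold_box K :: real ^ 'n \<Rightarrow> _) \<in> borel_measurable borel" for K :: real
  proof (cases "K = 0")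
    case False
    then show ?thesis unfolding fold_box_def
      by (intro borel_measurable_continuous_onI continuous_intros) auto
  next
    case True
    have "fold_box 0 = (\<lambda>_ :: real ^ 'n. 0)" by (simp add: fold_box_def fun_eq_iff vec_eq_iff)
    then show ?thesis using True by simp
  qed
  have [measurable_cong]: "sets L = sets borel" by fact
  have C: "0 \<le> C" using sq(2)[of 0] by (rule order_trans[rotated]) simp
  have fM: "integrable M (\<lambda>\<omega>. g (fold_box K (Y n \<omega>)))" "integrable M (\<lambda>\<omega>. g (Y n \<omega>))" for n K
    by (intro M.integrable_const_bound[of _ B]; auto simp: g(2))+
  have tail: "\<bar>(\<integral>\<omega>. g (Y n \<omega>) \<partial>M) - (\<integral>\<omega>. g (fold_box K (Y n \<omega>)) \<partial>M)\<bar> \<le> 2 * B * C / K\<^sup>2"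
    if K: "0 < K" for n K
  proof -
    \<comment> \<open>Inside the ball the difference is 0. Outside it is at most
      \<open>2 * B\<close>, and \<open>(norm y)\<^sup>2 / K\<^sup>2\<close> is at least 1.\<close>
    have pw: "\<bar>g y - g (fold_box K y)\<bar> \<le> 2 * B / K\<^sup>2 * (norm y)\<^sup>2" for y
    proof (cases "norm y \<le> K")
      case True
      then show ?thesis using K B by (simp add: fold_box_id)
    next
      case False
      then have "1 \<le> (norm y)\<^sup>2 / K\<^sup>2" using K by (simp add: power_mono)
      then have "2 * B * 1 \<le> 2 * B * ((norm y)\<^sup>2 / K\<^sup>2)" using B by (intro mult_left_mono) auto
      then show ?thesis using g(2)[of y] g(2)[of "fold_box K y"] by simp
    qed
    have "\<bar>\<integral>\<omega>. g (Y n \<omega>) - g (fold_box K (Y n \<omega>)) \<partial>M\<bar> \<le> (\<integral>\<omega>. 2 * B / K\<^sup>2 * (norm (Y n \<omega>))\<^sup>2 \<partial>M)"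
      by (rule order_trans[OF integral_abs_bound integral_mono]) (use pw fM sq in auto)
    also have "\<dots> \<le> 2 * B / K\<^sup>2 * C"
      using sq(2)[of n] B by (simp add: divide_right_mono mult_left_mono)
    finally show ?thesis using fM by simp
  qed
  have limL: "(\<lambda>m. \<integral>y. g (fold_box (real m) y) \<partial>L) \<longlonglongrightarrow> (\<integral>y. g y \<partial>L)"
  proof (rule integral_dominated_convergence[where w = "\<lambda>_. B"])
    show "AE y in L. (\<lambda>m. g (fold_box (real m) y)) \<longlonglongrightarrow> g y"
    proof (rule AE_I2)
      fix y :: "real ^ 'n"
      obtain m0 :: nat where m0: "norm y < real m0" using reals_Archimedean2 by blast
      have "\<forall>\<^sub>F m in sequentially. g (fold_box (real m) y) = g y"
        using eventually_ge_at_top[of "Suc m0"]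
        by eventually_elim (use m0 in \<open>simp add: fold_box_id\<close>)
      then show "(\<lambda>m. g (fold_box (real m) y)) \<longlonglongrightarrow> g y" by (rule tendsto_eventually)
    qed
  qed (auto simp: g(2))
  have lim0: "(\<lambda>m. 2 * B * C / (real m)\<^sup>2) \<longlonglongrightarrow> 0"
    by (intro tendsto_divide_0[OF tendsto_const] filterlim_at_top_imp_at_infinity
        filterlim_pow_at_top filterlim_real_sequentially) auto
  show "(\<lambda>n. \<integral>\<omega>. g (Y n \<omega>) \<partial>M) \<longlonglongrightarrow> (\<integral>y. g y \<partial>L)"
  proof (rule LIMSEQ_I)
    fix r :: real assume r: "0 < r"
    have "\<forall>\<^sub>F m in sequentially. 0 < m \<and> 2 * B * C / (real m)\<^sup>2 < r / 3 \<and>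
        \<bar>(\<integral>y. g (fold_box (real m) y) \<partial>L) - (\<integral>y. g y \<partial>L)\<bar> < r / 3"
      using eventually_gt_at_top[of "0::nat"] order_tendstoD(2)[OF lim0, of "r / 3"]
        tendstoD[OF limL, of "r / 3"] r by (simp add: dist_real_def eventually_conj)
    then obtain m :: nat where m: "0 < m" "2 * B * C / (real m)\<^sup>2 < r / 3"
        "\<bar>(\<integral>y. g (fold_box (real m) y) \<partial>L) - (\<integral>y. g y \<partial>L)\<bar> < r / 3"
      by (auto simp: eventually_sequentially)
    have "(\<lambda>n. \<integral>\<omega>. g (fold_box (real m) (Y n \<omega>)) \<partial>M) \<longlonglongrightarrow> (\<integral>y. g (fold_box (real m) y) \<partial>L)"
      using m(1) by (intro expectation_fold_box_tendsto[OF M L Y char g]) auto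
    from LIMSEQ_D[OF this, of "r / 3"] r obtain n0 where n0: "\<And>n. n \<ge> n0 \<Longrightarrow>
        \<bar>(\<integral>\<omega>. g (fold_box (real m) (Y n \<omega>)) \<partial>M) - (\<integral>y. g (fold_box (real m) y) \<partial>L)\<bar> < r / 3"
      by auto
    have "norm ((\<integral>\<omega>. g (Y n \<omega>) \<partial>M) - (\<integral>y. g y \<partial>L)) < r" if "n \<ge> n0" for n
      using n0[OF that] tail[of "real m" n] m unfolding real_norm_def of_nat_0_less_iff by linarith
    then show "\<exists>n0. \<forall>n\<ge>n0. norm ((\<integral>\<omega>. g (Y n \<omega>) \<partial>M) - (\<integral>y. g y \<partial>L)) < r" by blast
  qed
qed

subsection \<open>Laws of large numbers\<close>

context prob_space
begin

lemma indep_vars_reindex: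
  assumes indep: "indep_vars N X I" and inj: "inj_on h J" and sub: "h ` J \<subseteq> I"
  shows "indep_vars (\<lambda>j. N (h j)) (\<lambda>j. X (h j)) J"
  unfolding indep_vars_def2
proof (intro conjI ballI indep_setsI)
  let ?F = "\<lambda>i. {X i -` A \<inter> space M |A. A \<in> sets (N i)}"
  have F: "indep_sets ?F I" using indep by (simp add: indep_vars_def2)
  show "random_variable (N (h j)) (X (h j))" if "j \<in> J" for j
    using indep sub that by (auto simp: indep_vars_def2)
  show "?F (h j) \<subseteq> events" if "j \<in> J" for j
    using F sub that by (auto simp: indep_sets_def)
  fix A K assume K: "K \<noteq> {}" "K \<subseteq> J" "finite K" and A: "\<forall>j\<in>K. A j \<in> ?F (h j)"
  have injK: "inj_on h K" using inj K by (auto intro: inj_on_subset)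
  let ?A = "\<lambda>i. A (the_inv_into K h i)"
  have inv: "the_inv_into K h (h j) = j" if "j \<in> K" for j
    using injK that by (rule the_inv_into_f_f)
  have "prob (\<Inter>i\<in>h ` K. ?A i) = (\<Prod>i\<in>h ` K. prob (?A i))"
    by (rule indep_setsD[OF F]) (use K sub A in \<open>auto simp: inv\<close>)
  then show "prob (\<Inter>j\<in>K. A j) = (\<Prod>j\<in>K. prob (A j))"
    by (simp add: inv prod.reindex[OF injK])
qed

text \<open>The cross terms vanish: each new summand is centred and independent of the sum of the
  others, so the expectation of their product factors and is 0.\<close>

lemma indep_sum_square:
  fixes X :: "'i \<Rightarrow> 'a \<Rightarrow> real"
  assumes "finite I" "indep_vars (\<lambda>_. borel) X I"
    and "\<And>i. i \<in> I \<Longrightarrow> integrable M (\<lambda>\<omega>. (X i \<omega>)\<^sup>2)"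
    and "\<And>i. i \<in> I \<Longrightarrow> expectation (X i) = 0"
  shows "integrable M (\<lambda>\<omega>. (\<Sum>i\<in>I. X i \<omega>)\<^sup>2) \<and>
    expectation (\<lambda>\<omega>. (\<Sum>i\<in>I. X i \<omega>)\<^sup>2) = (\<Sum>i\<in>I. expectation (\<lambda>\<omega>. (X i \<omega>)\<^sup>2))"
  using assms
proof (induction I rule: finite_induct)
  case (insert i I)
  have rv: "random_variable borel (X j)" if "j \<in> insert i I" for j
    using insert.prems(1) that unfolding indep_vars_def2 by blast
  let ?S = "\<lambda>\<omega>. \<Sum>i\<in>I. X i \<omega>"
  have IH: "integrable M (\<lambda>\<omega>. (?S \<omega>)\<^sup>2)"
      "expectation (\<lambda>\<omega>. (?S \<omega>)\<^sup>2) = (\<Sum>i\<in>I. expectation (\<lambda>\<omega>. (X i \<omega>)\<^sup>2))"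
    using insert.IH[OF indep_vars_subset[OF insert.prems(1)]] insert.prems(2,3) by auto
  have Xi: "integrable M (X i)"
    by (rule square_integrable_imp_integrable) (simp_all add: insert.prems(2) rv)
  have S: "integrable M ?S"
    by (rule Bochner_Integration.integrable_sum, rule square_integrable_imp_integrable)
      (simp_all add: insert.prems(2) rv)
  have iv: "indep_var borel (X i) borel ?S"
    using insert by (intro indep_vars_sum) auto
  have cross: "integrable M (\<lambda>\<omega>. X i \<omega> * ?S \<omega>)" "expectation (\<lambda>\<omega>. X i \<omega> * ?S \<omega>) = 0"
    using indep_var_integrable[OF iv Xi S] indep_var_lebesgue_integral[OF iv Xi S] insert.prems(3)
    by auto
  have "(\<lambda>\<omega>. (\<Sum>i\<in>insert i I. X i \<omega>)\<^sup>2) = (\<lambda>\<omega>. (X i \<omega>)\<^sup>2 + 2 * (X i \<omega> * ?S \<omega>) + (?S \<omega>)\<^sup>2)"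
    using insert.hyps by (simp add: power2_sum fun_eq_iff algebra_simps)
  then show ?case
    using insert.hyps insert.prems(2)[of i] cross IH by simp
qed simp

text \<open>The variance of \<open>\<bar>Z \<omega>\<bar>\<close> is nonnegative.\<close>

lemma expectation_abs_le_sqrt:
  fixes Z :: "'a \<Rightarrow> real"
  assumes "random_variable borel Z" "integrable M (\<lambda>\<omega>. (Z \<omega>)\<^sup>2)"
  shows "expectation (\<lambda>\<omega>. \<bar>Z \<omega>\<bar>) \<le> sqrt (expectation (\<lambda>\<omega>. (Z \<omega>)\<^sup>2))"
proof -
  have "integrable M Z" by (rule square_integrable_imp_integrable[OF assms])
  then have "0 \<le> expectation (\<lambda>\<omega>. (Z \<omega>)\<^sup>2) - (expectation (\<lambda>\<omega>. \<bar>Z \<omega>\<bar>))\<^sup>2"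
    using variance_eq[of "\<lambda>\<omega>. \<bar>Z \<omega>\<bar>"] variance_positive[of "\<lambda>\<omega>. \<bar>Z \<omega>\<bar>"] assms(2) by simp
  then show ?thesis by (intro real_le_rsqrt) simp
qed

text \<open>Additivity of variances, with the constants expressed through the common law
  \<open>D\<close>. It serves the truncated sample in the weak law and the projections of the sample
  in the central limit theorem.\<close>

lemma sample_mean_square:
  fixes X :: "nat \<Rightarrow> 'a \<Rightarrow> real"
  assumes indep: "indep_vars (\<lambda>_. borel) X {1..}"
    and distr: "\<And>n. 1 \<le> n \<Longrightarrow> distr M borel (X n) = D"
    and sq: "integrable D (\<lambda>t. t\<^sup>2)"
  defines "m \<equiv> \<integral>t. t \<partial>D"
  shows "integrable M (\<lambda>\<omega>. (\<Sum>n=1..N. X n \<omega> - m)\<^sup>2)"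
    and "expectation (\<lambda>\<omega>. (\<Sum>n=1..N. X n \<omega> - m)\<^sup>2) = real N * (\<integral>t. (t - m)\<^sup>2 \<partial>D)"
proof -
  have rv: "random_variable borel (X n)" if "1 \<le> n" for n
    using indep that by (simp add: indep_vars_def2)
  interpret D: prob_space D
    using prob_space_distr[OF rv[of 1]] distr[of 1] by simp
  have sD [measurable_cong]: "sets D = sets borel" using distr[of 1] by (metis order_refl sets_distr)
  have iD: "integrable D (\<lambda>t. t)" by (rule D.square_integrable_imp_integrable[OF _ sq]) simp
  have "integrable D (\<lambda>t. (t - m)\<^sup>2)"
    unfolding power2_diff
    by (intro Bochner_Integration.integrable_add Bochner_Integration.integrable_diff sq
        integrable_mult_left integrable_mult_right iD D.integrable_const)
  then have X2: "integrable M (\<lambda>\<omega>. (X n \<omega> - m)\<^sup>2)"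
      "expectation (\<lambda>\<omega>. (X n \<omega> - m)\<^sup>2) = (\<integral>t. (t - m)\<^sup>2 \<partial>D)"
    if "1 \<le> n" for n
    using rv[OF that] by (auto simp: distr[OF that, symmetric] integrable_distr_eq integral_distr)
  have X1: "expectation (\<lambda>\<omega>. X n \<omega> - m) = 0" if "1 \<le> n" for n
  proof -
    have "integrable M (X n)"
      by (rule integrable_distr[OF rv[OF that], where f = "\<lambda>t. t"]) (simp only: distr[OF that] iD)
    moreover have "expectation (X n) = m"
      using rv[OF that] by (simp add: m_def distr[OF that, symmetric] integral_distr)
    ultimately show ?thesis by (simp add: prob_space)
  qed
  have iv: "indep_vars (\<lambda>_. borel) (\<lambda>n \<omega>. X n \<omega> - m) {1..N}"
    by (rule indep_vars_compose2[OF indep_vars_subset[OF indep]]) auto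
  note s = indep_sum_square[OF _ iv]
  show "integrable M (\<lambda>\<omega>. (\<Sum>n=1..N. X n \<omega> - m)\<^sup>2)"
    using s X1 X2 by simp
  show "expectation (\<lambda>\<omega>. (\<Sum>n=1..N. X n \<omega> - m)\<^sup>2) = real N * (\<integral>t. (t - m)\<^sup>2 \<partial>D)"
    using s X1 X2 by simp
qed

text \<open>The squared likelihood ratio need not have a second moment, so Chebyshev's inequality is
  applied only after truncation.\<close>

theorem weak_law_L1:
  fixes X :: "nat \<Rightarrow> 'a \<Rightarrow> real"
  assumes indep: "indep_vars (\<lambda>_. borel) X {1..}"
    and distr: "\<And>n. 1 \<le> n \<Longrightarrow> distr M borel (X n) = D"
    and int: "integrable D (\<lambda>t. t)"
  shows "(\<lambda>N. expectation (\<lambda>\<omega>. \<bar>1 / real N * (\<Sum>n=1..N. X n \<omega>) - (\<integral>t. t \<partial>D)\<bar>)) \<longlonglongrightarrow> 0"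
proof (rule LIMSEQ_I)
  fix r :: real assume r: "0 < r"
  have rv: "random_variable borel (X n)" if "1 \<le> n" for n
    using indep that by (simp add: indep_vars_def2)
  interpret D: prob_space D
    using prob_space_distr[OF rv[of 1]] distr[of 1] by simp
  have sD [measurable_cong]: "sets D = sets borel" using distr[of 1] by (metis order_refl sets_distr)
  define T where "T c t = (if \<bar>t\<bar> \<le> c then t else 0)" for c t :: real
  have [measurable]: "T c \<in> borel_measurable borel" for c unfolding T_def by measurable
  \<comment> \<open>Dominated convergence with majorant \<open>\<bar>t\<bar>\<close> yields a level
    \<open>c\<close> for which the part cut off by \<open>T c\<close> has first absolute moment
    below \<open>r / 3\<close>.\<close>
  have "(\<lambda>k. \<integral>t. \<bar>t - T (real k) t\<bar> \<partial>D) \<longlonglongrightarrow> (\<integral>t. 0 \<partial>D)"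
  proof (rule integral_dominated_convergence[where w = "\<lambda>t. \<bar>t\<bar>"])
    show "AE t in D. (\<lambda>k. \<bar>t - T (real k) t\<bar>) \<longlonglongrightarrow> 0"
    proof (rule AE_I2)
      fix t :: real
      obtain k0 :: nat where k0: "\<bar>t\<bar> < real k0" using reals_Archimedean2 by blast
      have "\<forall>\<^sub>F k in sequentially. \<bar>t - T (real k) t\<bar> = 0"
        using eventually_ge_at_top[of k0] by eventually_elim (use k0 in \<open>simp add: T_def\<close>)
      then show "(\<lambda>k. \<bar>t - T (real k) t\<bar>) \<longlonglongrightarrow> 0" by (rule tendsto_eventually)
    qed
    show "AE t in D. norm \<bar>t - T (real k) t\<bar> \<le> \<bar>t\<bar>" for k
      by (simp add: T_def)
    show "integrable D (\<lambda>t. \<bar>t\<bar>)" using int by (rule integrable_abs)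
  qed simp_all
  then have "(\<lambda>k. \<integral>t. \<bar>t - T (real k) t\<bar> \<partial>D) \<longlonglongrightarrow> 0" by simp
  then have "\<forall>\<^sub>F k in sequentially. (\<integral>t. \<bar>t - T (real k) t\<bar> \<partial>D) < r / 3"
    using r by (intro order_tendstoD) auto
  then obtain c where c: "(\<integral>t. \<bar>t - T c t\<bar> \<partial>D) < r / 3"
    by (auto simp: eventually_sequentially)
  have iT: "integrable D (T c)"
    by (rule D.integrable_const_bound[of _ "\<bar>c\<bar>"]) (auto simp: T_def)
  have iT2: "integrable D (\<lambda>t. (T c t)\<^sup>2)"
    by (rule D.integrable_const_bound[of _ "\<bar>c\<bar>\<^sup>2"]) (auto simp: T_def abs_le_square_iff[symmetric])
  define mc where "mc = (\<integral>t. T c t \<partial>D)"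
  define m where "m = (\<integral>t. t \<partial>D)"
  define V where "V = (\<integral>t. (t - mc)\<^sup>2 \<partial>distr D borel (T c))"
  have mdiff: "\<bar>mc - m\<bar> < r / 3"
  proof -
    have "mc - m = - (\<integral>t. t - T c t \<partial>D)"
      unfolding mc_def m_def Bochner_Integration.integral_diff[OF int iT] by simp
    then have "\<bar>mc - m\<bar> \<le> (\<integral>t. \<bar>t - T c t\<bar> \<partial>D)" using integral_abs_bound[of D "\<lambda>t. t - T c t"] by simp
    then show ?thesis using c by simp
  qed
  have TX: "indep_vars (\<lambda>_. borel) (\<lambda>n \<omega>. T c (X n \<omega>)) {1..}"
    by (rule indep_vars_compose2[OF indep]) auto
  have Td: "distr M borel (\<lambda>\<omega>. T c (X n \<omega>)) = distr D borel (T c)" if "1 \<le> n" for n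
    using rv[OF that] by (simp add: distr[OF that, symmetric] distr_distr comp_def)
  have Tsq: "integrable (distr D borel (T c)) (\<lambda>t. t\<^sup>2)"
    using iT2 by (simp add: integrable_distr_eq)
  have Tm: "(\<integral>t. t \<partial>distr D borel (T c)) = mc" by (simp add: mc_def integral_distr)
  note sm = sample_mean_square[OF TX Td Tsq, unfolded Tm]
  have rest: "integrable M (\<lambda>\<omega>. \<bar>X n \<omega> - T c (X n \<omega>)\<bar>)"
      "expectation (\<lambda>\<omega>. \<bar>X n \<omega> - T c (X n \<omega>)\<bar>) = (\<integral>t. \<bar>t - T c t\<bar> \<partial>D)" if "1 \<le> n" for n
  proof -
    have "integrable D (\<lambda>t. \<bar>t - T c t\<bar>)"
      by (intro integrable_abs Bochner_Integration.integrable_diff int iT)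
    then show "integrable M (\<lambda>\<omega>. \<bar>X n \<omega> - T c (X n \<omega>)\<bar>)"
      using rv[OF that] by (simp add: distr[OF that, symmetric] integrable_distr_eq)
    show "expectation (\<lambda>\<omega>. \<bar>X n \<omega> - T c (X n \<omega>)\<bar>) = (\<integral>t. \<bar>t - T c t\<bar> \<partial>D)"
      using rv[OF that] by (simp add: distr[OF that, symmetric] integral_distr)
  qed
  \<comment> \<open>The error splits into the centred mean of the truncated variables, at most
    \<open>sqrt (V / real N)\<close> in mean, the mean of the parts cut off, below
    \<open>r / 3\<close>, and the bias of the truncated expectation, below \<open>r / 3\<close> by
    \<open>mdiff\<close>.\<close>
  have bound: "expectation (\<lambda>\<omega>. \<bar>1 / real N * (\<Sum>n=1..N. X n \<omega>) - m\<bar>)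
      \<le> sqrt (V / real N) + 2 * r / 3" if N: "1 \<le> N" for N
  proof -
    let ?A = "\<lambda>\<omega>. 1 / real N * (\<Sum>n=1..N. T c (X n \<omega>) - mc)"
    let ?B = "\<lambda>\<omega>. 1 / real N * (\<Sum>n=1..N. \<bar>X n \<omega> - T c (X n \<omega>)\<bar>)"
    have A2: "integrable M (\<lambda>\<omega>. (?A \<omega>)\<^sup>2)"
      unfolding power_mult_distrib using sm(1)[of N] by simp
    have EA2: "expectation (\<lambda>\<omega>. (?A \<omega>)\<^sup>2) = V / real N"
      unfolding power_mult_distrib using sm(2)[of N] N
      by (simp add: V_def power2_eq_square field_simps)
    have Arv: "random_variable borel ?A"
      by (intro borel_measurable_times borel_measurable_const borel_measurable_sum
          borel_measurable_diff measurable_compose[OF rv]) simp_all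
    have Ai: "integrable M (\<lambda>\<omega>. \<bar>?A \<omega>\<bar>)"
      by (intro integrable_abs square_integrable_imp_integrable[OF Arv A2])
    have Bi: "integrable M ?B" using rest by (intro integrable_mult_right Bochner_Integration.integrable_sum) auto
    have EB: "expectation ?B < r / 3"
      using rest c N by (simp add: Bochner_Integration.integral_sum)
    have pw: "\<bar>1 / real N * (\<Sum>n=1..N. X n \<omega>) - m\<bar> \<le> \<bar>?A \<omega>\<bar> + ?B \<omega> + r / 3" for \<omega>
    proof -
      have "1 / real N * (\<Sum>n=1..N. X n \<omega>) - m =
          ?A \<omega> + 1 / real N * (\<Sum>n=1..N. X n \<omega> - T c (X n \<omega>)) + (mc - m)"
        using N by (simp add: sum_subtractf field_simps)
      moreover have "\<bar>1 / real N * (\<Sum>n=1..N. X n \<omega> - T c (X n \<omega>))\<bar> \<le> ?B \<omega>"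
        using sum_abs[of "\<lambda>n. X n \<omega> - T c (X n \<omega>)" "{1..N}"]
        by (simp add: abs_mult divide_right_mono)
      ultimately show ?thesis using mdiff by linarith
    qed
    have "integrable M (\<lambda>\<omega>. 1 / real N * (\<Sum>n=1..N. X n \<omega>))"
    proof (intro integrable_mult_right Bochner_Integration.integrable_sum)
      fix n assume "n \<in> {1..N}"
      then have "1 \<le> n" by simp
      then show "integrable M (X n)"
        by (intro integrable_distr[OF rv, where f = "\<lambda>t. t"]) (simp_all only: distr int)
    qed
    then have "expectation (\<lambda>\<omega>. \<bar>1 / real N * (\<Sum>n=1..N. X n \<omega>) - m\<bar>)
        \<le> expectation (\<lambda>\<omega>. \<bar>?A \<omega>\<bar> + ?B \<omega> + r / 3)"
      using pw Ai Bi by (intro integral_mono) auto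
    also have "\<dots> = expectation (\<lambda>\<omega>. \<bar>?A \<omega>\<bar>) + expectation ?B + r / 3"
      using Ai Bi by (simp add: prob_space)
    also have "\<dots> \<le> sqrt (V / real N) + 2 * r / 3"
      using expectation_abs_le_sqrt[OF Arv A2] EB unfolding EA2 by linarith
    finally show ?thesis .
  qed
  have "(\<lambda>N. sqrt (V / real N)) \<longlonglongrightarrow> sqrt 0"
    by (intro tendsto_real_sqrt lim_const_over_n)
  then have "\<forall>\<^sub>F N in sequentially. sqrt (V / real N) < r / 3"
    using r by (intro order_tendstoD) auto
  then have "\<forall>\<^sub>F N in sequentially. 1 \<le> N \<and> sqrt (V / real N) < r / 3"
    using eventually_ge_at_top[of "1::nat"] by (simp add: eventually_conj)
  then obtain N0 where N0: "\<And>N. N0 \<le> N \<Longrightarrow> 1 \<le> N \<and> sqrt (V / real N) < r / 3"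
    by (auto simp: eventually_sequentially)
  have "norm (expectation (\<lambda>\<omega>. \<bar>1 / real N * (\<Sum>n=1..N. X n \<omega>) - (\<integral>t. t \<partial>D)\<bar>) - 0) < r"
    if "N0 \<le> N" for N
    using bound[of N] N0[OF that] unfolding m_def by (simp add: abs_of_nonneg)
  then show "\<exists>N0. \<forall>N\<ge>N0. norm (expectation (\<lambda>\<omega>. \<bar>1 / real N * (\<Sum>n=1..N. X n \<omega>) - (\<integral>t. t \<partial>D)\<bar>) - 0) < r"
    by blast
qed

section \<open>Convergence in probability: criterion and stability\<close>

lemma conv_in_prob_of_L1:
  fixes Y :: "nat \<Rightarrow> 'a \<Rightarrow> real"
  assumes int: "\<And>n. integrable M (Y n)"
    and lim: "(\<lambda>n. expectation (\<lambda>\<omega>. \<bar>Y n \<omega> - c\<bar>)) \<longlonglongrightarrow> 0"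
  shows "conv_in_prob M Y c"
  unfolding conv_in_prob_def
proof (intro conjI allI impI)
  note [measurable] = borel_measurable_integrable[OF int]
  show "Y n \<in> borel_measurable M" for n by simp
  fix \<epsilon> :: real assume e: "0 < \<epsilon>"
  show "(\<lambda>n. prob {\<omega> \<in> space M. dist (Y n \<omega>) c > \<epsilon>}) \<longlonglongrightarrow> 0"
  proof (rule tendsto_sandwich[OF _ _ tendsto_const])
    show "(\<lambda>n. expectation (\<lambda>\<omega>. \<bar>Y n \<omega> - c\<bar>) / \<epsilon>) \<longlonglongrightarrow> 0"
      using tendsto_divide[OF lim tendsto_const, of \<epsilon>] e by simp
    \<comment> \<open>Markov's inequality for the absolute deviation.\<close>
    have "prob {\<omega> \<in> space M. dist (Y n \<omega>) c > \<epsilon>} \<le> expectation (\<lambda>\<omega>. \<bar>Y n \<omega> - c\<bar>) / \<epsilon>" for n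
    proof -
      have "prob {\<omega> \<in> space M. dist (Y n \<omega>) c > \<epsilon>} \<le> prob {\<omega> \<in> space M. \<bar>Y n \<omega> - c\<bar> \<ge> \<epsilon>}"
        by (intro finite_measure_mono) (auto simp: dist_real_def)
      also have "\<dots> \<le> expectation (\<lambda>\<omega>. \<bar>Y n \<omega> - c\<bar>) / \<epsilon>"
        using int e by (intro integral_Markov_inequality_measure[where A = "space M"]) auto
      finally show ?thesis .
    qed
    then show "\<forall>\<^sub>F n in sequentially. prob {\<omega> \<in> space M. dist (Y n \<omega>) c > \<epsilon>}
        \<le> expectation (\<lambda>\<omega>. \<bar>Y n \<omega> - c\<bar>) / \<epsilon>" by simp
  qed simp
qed

text \<open>The distance of pairs is at most the sum of the distances, so a deviation beyond
  \<open>\<epsilon>\<close> forces one coordinate beyond \<open>\<epsilon> / 2\<close>; a union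
  bound finishes.\<close>

lemma conv_in_prob_Pair:
  fixes Y :: "nat \<Rightarrow> 'a \<Rightarrow> 'b::{metric_space, second_countable_topology}"
    and Z :: "nat \<Rightarrow> 'a \<Rightarrow> 'c::{metric_space, second_countable_topology}"
  assumes Y: "conv_in_prob M Y a" and Z: "conv_in_prob M Z b"
  shows "conv_in_prob M (\<lambda>n \<omega>. (Y n \<omega>, Z n \<omega>)) (a, b)"
  unfolding conv_in_prob_def
proof (intro conjI allI impI)
  have [measurable]: "Y n \<in> borel_measurable M" "Z n \<in> borel_measurable M" for n
    using Y Z by (auto simp: conv_in_prob_def)
  show "(\<lambda>\<omega>. (Y n \<omega>, Z n \<omega>)) \<in> borel_measurable M" for n by simp
  fix \<epsilon> :: real assume e: "0 < \<epsilon>"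
  let ?A = "\<lambda>n. {\<omega> \<in> space M. dist (Y n \<omega>) a > \<epsilon> / 2}"
  let ?B = "\<lambda>n. {\<omega> \<in> space M. dist (Z n \<omega>) b > \<epsilon> / 2}"
  show "(\<lambda>n. prob {\<omega> \<in> space M. dist (Y n \<omega>, Z n \<omega>) (a, b) > \<epsilon>}) \<longlonglongrightarrow> 0"
  proof (rule tendsto_sandwich[OF _ _ tendsto_const])
    have "(\<lambda>n. prob (?A n)) \<longlonglongrightarrow> 0" "(\<lambda>n. prob (?B n)) \<longlonglongrightarrow> 0"
      using Y Z e unfolding conv_in_prob_def by (meson half_gt_zero)+
    from tendsto_add[OF this] show "(\<lambda>n. prob (?A n) + prob (?B n)) \<longlonglongrightarrow> 0"
      unfolding add_0 .
    have "prob {\<omega> \<in> space M. dist (Y n \<omega>, Z n \<omega>) (a, b) > \<epsilon>} \<le> prob (?A n) + prob (?B n)" for n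
    proof -
      have "dist (y, z) (a, b) \<le> dist y a + dist z b" for y :: 'b and z :: 'c
        unfolding dist_Pair_Pair by (rule sqrt_sum_squares_le_sum) auto
      then have "{\<omega> \<in> space M. dist (Y n \<omega>, Z n \<omega>) (a, b) > \<epsilon>} \<subseteq> ?A n \<union> ?B n"
        by (smt (verit) Un_iff field_sum_of_halves mem_Collect_eq subsetI)
      then have "prob {\<omega> \<in> space M. dist (Y n \<omega>, Z n \<omega>) (a, b) > \<epsilon>} \<le> prob (?A n \<union> ?B n)"
        by (intro finite_measure_mono) auto
      also have "\<dots> \<le> prob (?A n) + prob (?B n)" by (intro measure_Un_le) auto
      finally show ?thesis .
    qed
    then show "\<forall>\<^sub>F n in sequentially. prob {\<omega> \<in> space M. dist (Y n \<omega>, Z n \<omega>) (a, b) > \<epsilon>}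
        \<le> prob (?A n) + prob (?B n)" by simp
  qed simp
qed

text \<open>The limit is a constant, so one \<open>d\<close> from continuity at \<open>a\<close>
  serves every \<open>\<omega>\<close>. The radius is halved because the events are strict: a
  distance of at least \<open>d\<close> exceeds \<open>d / 2\<close>.\<close>

lemma conv_in_prob_continuous:
  fixes Y :: "nat \<Rightarrow> 'a \<Rightarrow> 'b::{metric_space, second_countable_topology}"
    and h :: "'b \<Rightarrow> 'c::metric_space"
  assumes Y: "conv_in_prob M Y a" and h: "continuous_on UNIV h"
  shows "conv_in_prob M (\<lambda>n \<omega>. h (Y n \<omega>)) (h a)"
  unfolding conv_in_prob_def
proof (intro conjI allI impI)
  have [measurable]: "Y n \<in> borel_measurable M" for n
    using Y by (auto simp: conv_in_prob_def)
  have [measurable]: "h \<in> borel_measurable borel"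
    using h by (rule borel_measurable_continuous_onI)
  show "(\<lambda>\<omega>. h (Y n \<omega>)) \<in> borel_measurable M" for n by simp
  fix \<epsilon> :: real assume e: "0 < \<epsilon>"
  then obtain d where d: "0 < d" "\<And>y. dist y a < d \<Longrightarrow> dist (h y) (h a) < \<epsilon>"
    using h by (metis UNIV_I continuous_on_iff)
  show "(\<lambda>n. prob {\<omega> \<in> space M. dist (h (Y n \<omega>)) (h a) > \<epsilon>}) \<longlonglongrightarrow> 0"
  proof (rule tendsto_sandwich[OF _ _ tendsto_const])
    show "(\<lambda>n. prob {\<omega> \<in> space M. dist (Y n \<omega>) a > d / 2}) \<longlonglongrightarrow> 0"
      using Y d(1) unfolding conv_in_prob_def by (meson half_gt_zero)
    have "{\<omega> \<in> space M. dist (h (Y n \<omega>)) (h a) > \<epsilon>} \<subseteq> {\<omega> \<in> space M. dist (Y n \<omega>) a > d / 2}" for n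
      using d by (smt (verit) Collect_mono field_sum_of_halves)
    then show "\<forall>\<^sub>F n in sequentially. prob {\<omega> \<in> space M. dist (h (Y n \<omega>)) (h a) > \<epsilon>}
        \<le> prob {\<omega> \<in> space M. dist (Y n \<omega>) a > d / 2}"
      by (intro always_eventually allI finite_measure_mono) auto
  qed simp
qed

end

subsection \<open>The multivariate central limit theorem\<close>

lemma borel_measurable_vec_lambda:
  assumes "\<And>k. (\<lambda>x. g x k) \<in> borel_measurable N"
  shows "(\<lambda>x. \<chi> k. (g x k :: real)) \<in> borel_measurable N"
  using assms by (subst borel_measurable_euclidean_space) (auto simp: Basis_vec_def inner_axis)

lemma measurable_vec_lambda [measurable]:
  "vec_lambda \<in> borel_measurable (Pi\<^sub>M (UNIV :: 'n::finite set) (\<lambda>_. lborel :: real measure))"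
proof -
  let ?N = "Pi\<^sub>M (UNIV :: 'n::finite set) (\<lambda>_. lborel :: real measure)"
  have "(\<lambda>x. x k) \<in> measurable ?N lborel" for k by (rule measurable_component_singleton) simp
  then have "(\<lambda>x. \<chi> k. x k) \<in> borel_measurable ?N" by (intro borel_measurable_vec_lambda) simp
  then show ?thesis by simp
qed

text \<open>Lebesgue measure is determined by the volumes of boxes, and the preimage of a box under
  \<open>vec_lambda\<close> is a product of intervals. This makes Fubini's theorem over the
  coordinates available.\<close>

lemma lborel_vec:
  "(lborel :: (real ^ 'n::finite) measure) = distr (\<Pi>\<^sub>M k\<in>UNIV. lborel) borel vec_lambda"
proof (rule lborel_eqI)
  interpret product_sigma_finite "\<lambda>_::'n. lborel :: real measure" ..
  fix l u :: "real ^ 'n" assume lu: "\<And>b. b \<in> Basis \<Longrightarrow> l \<bullet> b \<le> u \<bullet> b"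
  have lu': "l $ k \<le> u $ k" for k using lu[of "axis k 1"] by (simp add: inner_axis)
  have B: "Basis = range (\<lambda>k::'n. axis k (1::real))" by (auto simp: Basis_vec_def)
  have inj: "inj (\<lambda>k::'n. axis k (1::real))" by (simp add: inj_on_def axis_eq_axis)
  have "vec_lambda -` box l u \<inter> space (Pi\<^sub>M UNIV (\<lambda>_. lborel)) =
      PiE UNIV (\<lambda>k. {l $ k <..< u $ k})"
    by (auto simp: space_PiM mem_box_cart PiE_iff)
  then have "emeasure (distr (\<Pi>\<^sub>M k\<in>UNIV. lborel) borel vec_lambda) (box l u) =
      (\<Prod>k\<in>UNIV. ennreal (u $ k - l $ k))"
    using lu' by (simp add: emeasure_distr emeasure_PiM)
  also have "\<dots> = (\<Prod>b\<in>Basis. (u - l) \<bullet> b)"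
    unfolding B by (simp add: prod.reindex[OF inj] inner_axis prod_ennreal lu')
  finally show "emeasure (distr (\<Pi>\<^sub>M k\<in>UNIV. lborel) borel vec_lambda) (box l u) =
      (\<Prod>b\<in>Basis. (u - l) \<bullet> b)" .
qed simp

text \<open>Density and integrand both factor over the coordinates, so Fubini applies. With all
  factors 1 it gives the total mass, with waves the characteristic function.\<close>

lemma integral_std_multi_normal_prod:
  fixes h :: "'n::finite \<Rightarrow> real \<Rightarrow> complex"
  assumes h: "\<And>k. integrable std_normal_distribution (h k)"
  shows "(\<integral>z. (\<Prod>k\<in>UNIV. h k (z $ k)) \<partial>std_multi_normal) =
    (\<Prod>k\<in>UNIV. \<integral>t. h k t \<partial>std_normal_distribution)"
proof -
  interpret product_sigma_finite "\<lambda>_::'n. lborel :: real measure" ..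
  have [measurable]: "h k \<in> borel_measurable borel" for k
    using borel_measurable_integrable[OF h[of k]] by simp
  let ?H = "\<lambda>k t. std_normal_density t *\<^sub>R h k t"
  have H: "integrable lborel (?H k)" for k
    using h[of k] by (simp add: integrable_density)
  have "(\<integral>z. (\<Prod>k\<in>UNIV. h k (z $ k)) \<partial>std_multi_normal) =
      (\<integral>z. (\<Prod>k\<in>UNIV. std_normal_density ((z :: real ^ 'n) $ k)) *\<^sub>R (\<Prod>k\<in>UNIV. h k (z $ k)) \<partial>lborel)"
    unfolding std_multi_normal_def
    by (rule integral_density) (auto intro!: prod_nonneg)
  also have "\<dots> = (\<integral>z. (\<Prod>k\<in>UNIV. ?H k ((z :: real ^ 'n) $ k)) \<partial>lborel)"
    by (simp add: scaleR_conv_of_real prod.distrib)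
  also have "\<dots> = (\<integral>y. (\<Prod>k\<in>UNIV. ?H k (y k)) \<partial>(\<Pi>\<^sub>M k\<in>UNIV. lborel))"
    unfolding lborel_vec by (subst integral_distr) auto
  also have "\<dots> = (\<Prod>k\<in>UNIV. \<integral>t. ?H k t \<partial>lborel)"
    by (rule product_integral_prod[OF finite H])
  also have "\<dots> = (\<Prod>k\<in>UNIV. \<integral>t. h k t \<partial>std_normal_distribution)"
    by (simp add: integral_density)
  finally show ?thesis .
qed

lemma prob_space_std_multi_normal: "prob_space (std_multi_normal :: (real ^ 'n::finite) measure)"
proof (rule prob_spaceI)
  interpret prob_space std_normal_distribution by (rule prob_space_normal_density) simp
  have "measure (std_multi_normal :: (real ^ 'n) measure) (space std_multi_normal) = 1"
    using integral_std_multi_normal_prod[of "\<lambda>_::'n. \<lambda>_. 1"] prob_space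
    by (simp add: scaleR_conv_of_real)
  \<comment> \<open>\<open>measure\<close> sends infinite mass to 0, so the value 1 determines
    \<open>emeasure\<close>.\<close>
  then show "emeasure (std_multi_normal :: (real ^ 'n) measure) (space std_multi_normal) = 1"
    by (metis emeasure_eq_ennreal_measure ennreal_1 measure_zero_top zero_neq_one)
qed

lemma sets_std_multi_normal [simp]: "sets std_multi_normal = sets borel"
  by (simp add: std_multi_normal_def)

text \<open>The wave is a product of one-dimensional waves, and the one-dimensional Gaussian factors
  multiply by adding their exponents.\<close>

lemma char_std_multi_normal:
  "(\<integral>z. iexp (u \<bullet> z) \<partial>std_multi_normal) = exp (- complex_of_real (u \<bullet> u) / 2)"
proof -
  interpret prob_space std_normal_distribution by (rule prob_space_normal_density) simp
  have "(\<integral>z. iexp (u \<bullet> z) \<partial>std_multi_normal) =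
      (\<integral>z. (\<Prod>k\<in>UNIV. iexp (u $ k * z $ k)) \<partial>std_multi_normal)"
    by (simp add: inner_vec_def exp_sum sum_distrib_left)
  also have "\<dots> = (\<Prod>k\<in>UNIV. char std_normal_distribution (u $ k))"
    unfolding char_def
    by (rule integral_std_multi_normal_prod) (auto intro!: integrable_iexp)
  also have "\<dots> = exp (- complex_of_real (u \<bullet> u) / 2)"
    by (simp add: char_std_normal_distribution inner_vec_def exp_sum[symmetric] of_real_exp
        sum_negf sum_divide_distrib power2_eq_square)
  finally show ?thesis .
qed

section \<open>Normalized means of independent identically distributed random vectors\<close>

definition law_mean :: "(real ^ 'n::finite) measure \<Rightarrow> real ^ 'n" where
  "law_mean D = (\<integral>w. w \<partial>D)"

definition normalized_mean ::
  "(nat \<Rightarrow> 'a \<Rightarrow> real ^ 'n::finite) \<Rightarrow> (real ^ 'n) measure \<Rightarrow> nat \<Rightarrow> 'a \<Rightarrow> real ^ 'n" where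
  "normalized_mean W D N \<omega> = sqrt (real N) *\<^sub>R ((1 / real N) *\<^sub>R (\<Sum>n=1..N. W n \<omega>) - law_mean D)"

context prob_space
begin

context
  fixes W :: "nat \<Rightarrow> 'a \<Rightarrow> real ^ 'n::finite" and D :: "(real ^ 'n) measure"
  assumes indep: "indep_vars (\<lambda>_. borel) W {1..}"
    and distr: "\<And>n. 1 \<le> n \<Longrightarrow> distr M borel (W n) = D"
    and sq: "integrable D (\<lambda>w. (norm w)\<^sup>2)"
begin

lemma sample_measurable: "1 \<le> n \<Longrightarrow> random_variable borel (W n)"
  using indep by (simp add: indep_vars_def2)

lemma prob_space_law: "prob_space D" and sets_law: "sets D = sets borel"
  using prob_space_distr[OF sample_measurable[of 1]] distr[of 1] by (simp, metis order_refl sets_distr)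

lemma law_proj_square_integrable: "integrable D (\<lambda>w. (u \<bullet> w)\<^sup>2)"
proof (rule Bochner_Integration.integrable_bound)
  show "integrable D (\<lambda>w. (norm u)\<^sup>2 * (norm w)\<^sup>2)" using sq by simp
  show "(\<lambda>w. (u \<bullet> w)\<^sup>2) \<in> borel_measurable D" using sets_law by (simp cong: measurable_cong_sets)
  have "(u \<bullet> w)\<^sup>2 \<le> (norm u)\<^sup>2 * (norm w)\<^sup>2" for w
    using Cauchy_Schwarz_ineq[of u w] by (simp add: power2_norm_eq_inner)
  then show "AE w in D. norm ((u \<bullet> w)\<^sup>2) \<le> norm ((norm u)\<^sup>2 * (norm w)\<^sup>2)" by simp
qed

lemma law_integrable: "integrable D (\<lambda>w. w)"
proof -
  interpret D: prob_space D by (rule prob_space_law)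
  have "integrable D norm"
    by (rule D.square_integrable_imp_integrable[OF _ sq])
      (use sets_law in \<open>simp cong: measurable_cong_sets\<close>)
  then show ?thesis
    by (rule Bochner_Integration.integrable_bound) (use sets_law in \<open>simp_all cong: measurable_cong_sets\<close>)
qed

lemma proj_mean: "(\<integral>w. u \<bullet> w \<partial>D) = u \<bullet> law_mean D"
  unfolding law_mean_def by (rule integral_inner_right) (rule law_integrable)

lemma normalized_mean_measurable: "random_variable borel (normalized_mean W D N)"
  unfolding normalized_mean_def
  by (intro borel_measurable_scaleR borel_measurable_diff borel_measurable_sum
      borel_measurable_const sample_measurable) auto

text \<open>Along a direction \<open>u\<close> the normalized mean is a scaled sum of centred
  scalars, which opens the one-dimensional results. For \<open>N = 0\<close> both sides are
  0.\<close>

lemma proj_normalized_mean: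
  "u \<bullet> normalized_mean W D N \<omega> = 1 / sqrt (real N) * (\<Sum>n=1..N. u \<bullet> W n \<omega> - u \<bullet> law_mean D)"
proof (cases "N = 0")
  case False
  define r where "r = sqrt (real N)"
  have r: "r \<noteq> 0" "real N = r * r" using False by (simp_all add: r_def)
  have "u \<bullet> normalized_mean W D N \<omega> = r * (1 / (r * r) * (\<Sum>n=1..N. u \<bullet> W n \<omega>) - u \<bullet> law_mean D)"
    by (simp add: normalized_mean_def inner_diff_right inner_sum_right r_def)
  also have "\<dots> = 1 / r * ((\<Sum>n=1..N. u \<bullet> W n \<omega>) - (r * r) * (u \<bullet> law_mean D))"
    using r(1) by (simp add: field_simps)
  also have "\<dots> = 1 / r * (\<Sum>n=1..N. u \<bullet> W n \<omega> - u \<bullet> law_mean D)"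
    by (simp add: sum_subtractf r(2))
  finally show ?thesis by (simp only: r_def)
qed (simp add: normalized_mean_def)

text \<open>The factor \<open>1 / sqrt (real N)\<close> cancels the linear growth of the variance of
  the sum. The formula starts at \<open>N = 1\<close> because the normalized mean is 0 at
  \<open>N = 0\<close>.\<close>

lemma proj_normalized_mean_square:
  shows "integrable M (\<lambda>\<omega>. (u \<bullet> normalized_mean W D N \<omega>)\<^sup>2)"
    and "0 < N \<Longrightarrow>
      expectation (\<lambda>\<omega>. (u \<bullet> normalized_mean W D N \<omega>)\<^sup>2) = (\<integral>w. (u \<bullet> (w - law_mean D))\<^sup>2 \<partial>D)"
proof -
  note [measurable_cong] = sets_law
  let ?D = "distr D borel (\<lambda>w. u \<bullet> w)"
  have iv: "indep_vars (\<lambda>_. borel) (\<lambda>n \<omega>. u \<bullet> W n \<omega>) {1..}"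
    by (rule indep_vars_compose2[OF indep]) auto
  have d: "distr M borel (\<lambda>\<omega>. u \<bullet> W n \<omega>) = ?D" if "1 \<le> n" for n
    using sample_measurable[OF that] by (simp add: distr[OF that, symmetric] distr_distr comp_def)
  have s: "integrable ?D (\<lambda>t. t\<^sup>2)"
    using law_proj_square_integrable by (simp add: integrable_distr_eq)
  have m: "(\<integral>t. t \<partial>?D) = u \<bullet> law_mean D"
    by (simp add: integral_distr proj_mean)
  note sm = sample_mean_square[OF iv d s, unfolded m]
  show "integrable M (\<lambda>\<omega>. (u \<bullet> normalized_mean W D N \<omega>)\<^sup>2)"
    unfolding proj_normalized_mean power_mult_distrib using sm(1)[of N] by simp
  assume "0 < N"
  then show "expectation (\<lambda>\<omega>. (u \<bullet> normalized_mean W D N \<omega>)\<^sup>2) = (\<integral>w. (u \<bullet> (w - law_mean D))\<^sup>2 \<partial>D)"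
    unfolding proj_normalized_mean power_mult_distrib using sm(2)[of N]
    by (simp add: power_divide integral_distr inner_diff_right)
qed

text \<open>The Cramer--Wold idea: the one-dimensional central limit theorem is applied to the
  projection on \<open>u\<close>. It requires positive variance, so degenerate directions are
  treated apart: for \<open>v = 0\<close> the projection vanishes almost surely and the limit is
  1.\<close>

lemma char_normalized_mean_tendsto:
  fixes u :: "real ^ 'n"
  defines "v \<equiv> \<integral>w. (u \<bullet> (w - law_mean D))\<^sup>2 \<partial>D"
  shows "(\<lambda>N. expectation (\<lambda>\<omega>. iexp (u \<bullet> normalized_mean W D N \<omega>))) \<longlonglongrightarrow> exp (- complex_of_real v / 2)"
proof (cases "v = 0")
  case True
  have "expectation (\<lambda>\<omega>. iexp (u \<bullet> normalized_mean W D N \<omega>)) = 1" if N: "0 < N" for N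
  proof -
    note [measurable] = normalized_mean_measurable
    have "AE \<omega> in M. (u \<bullet> normalized_mean W D N \<omega>)\<^sup>2 = 0"
      using proj_normalized_mean_square[where u = u and N = N] N True
      by (subst integral_nonneg_eq_0_iff_AE[symmetric]) (auto simp: v_def)
    then have "expectation (\<lambda>\<omega>. iexp (u \<bullet> normalized_mean W D N \<omega>)) = expectation (\<lambda>\<omega>. 1)"
      by (intro integral_cong_AE) auto
    then show ?thesis by (simp add: prob_space)
  qed
  then have "\<forall>\<^sub>F N in sequentially. expectation (\<lambda>\<omega>. iexp (u \<bullet> normalized_mean W D N \<omega>)) = 1"
    by (rule eventually_mono[OF eventually_gt_at_top])
  then show ?thesis using True by (simp add: tendsto_eventually)
next
  case False
  note [measurable_cong] = sets_law
  have v: "0 < v" using False by (simp add: v_def less_le)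
  let ?X = "\<lambda>n \<omega>. u \<bullet> W (Suc n) \<omega> - u \<bullet> law_mean D"
  let ?S = "\<lambda>N \<omega>. \<Sum>n<N. ?X n \<omega>"
  have rvX: "random_variable borel (?X n)" for n
    using sample_measurable[of "Suc n"] by simp
  have dX: "distr M borel (?X n) = distr D borel (\<lambda>w. u \<bullet> w - u \<bullet> law_mean D)" for n
    using sample_measurable[of "Suc n"] by (simp add: distr[of "Suc n", symmetric] distr_distr comp_def)
  have Dsq: "integrable D (\<lambda>w. (u \<bullet> w - u \<bullet> law_mean D)\<^sup>2)"
  proof -
    interpret D: prob_space D by (rule prob_space_law)
    have "integrable D (\<lambda>w. u \<bullet> w)" by (rule integrable_inner_right) (rule law_integrable)
    then show ?thesis unfolding power2_diff
      by (intro Bochner_Integration.integrable_add Bochner_Integration.integrable_diff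
          law_proj_square_integrable integrable_mult_left integrable_mult_right D.integrable_const)
  qed
  have X2: "integrable M (\<lambda>\<omega>. (?X n \<omega>)\<^sup>2)" for n
    using integrable_distr_eq[OF rvX, of "\<lambda>t. t\<^sup>2" n] Dsq unfolding dX
    by (simp add: integrable_distr_eq)
  have EX: "expectation (?X n) = 0" for n
  proof -
    have n: "1 \<le> Suc n" by simp
    have "integrable M (W (Suc n))"
      by (rule integrable_distr[OF sample_measurable[OF n], where f = "\<lambda>w. w", unfolded distr[OF n], OF law_integrable])
    moreover have "expectation (\<lambda>\<omega>. u \<bullet> W (Suc n) \<omega>) = u \<bullet> law_mean D"
      using sample_measurable[of "Suc n"] proj_mean[of u] by (simp add: distr[of "Suc n", symmetric] integral_distr)
    ultimately show ?thesis by (simp add: prob_space)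
  qed
  have EX2: "expectation (\<lambda>\<omega>. (?X n \<omega>)\<^sup>2) = v" for n
    using sample_measurable[of "Suc n"] unfolding v_def
    by (simp add: distr[of "Suc n", symmetric] integral_distr inner_diff_right)
  have iv: "indep_vars (\<lambda>_. borel) ?X UNIV"
    using indep_vars_reindex[OF indep, of Suc UNIV]
    by (intro indep_vars_compose2[where Y = "\<lambda>_ w. u \<bullet> w - u \<bullet> law_mean D"]) auto
  have VX: "variance (?X n) = (sqrt v)\<^sup>2" for n
    unfolding EX using v EX2 by simp
  \<comment> \<open>This limit is standardized by \<open>sqrt v\<close>. Evaluating the
    characteristic functions at the argument \<open>sqrt v\<close> undoes the scaling.\<close>
  have "weak_conv_m (\<lambda>N. distr M borel (\<lambda>\<omega>. ?S N \<omega> / sqrt (N * (sqrt v)\<^sup>2))) std_normal_distribution"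
    by (rule central_limit_theorem_zero_mean[OF iv EX _ X2 VX dX]) (use v in simp)
  then have "(\<lambda>N. char (distr M borel (\<lambda>\<omega>. ?S N \<omega> / sqrt (N * (sqrt v)\<^sup>2))) (sqrt v))
      \<longlonglongrightarrow> char std_normal_distribution (sqrt v)"
    using rvX by (intro levy_continuity1 real_distribution_distr real_dist_normal_dist
        borel_measurable_divide borel_measurable_sum borel_measurable_const)
  moreover have "char std_normal_distribution (sqrt v) = exp (- complex_of_real v / 2)"
  proof -
    have "(complex_of_real (sqrt v))\<^sup>2 = complex_of_real v"
      using v by (simp flip: of_real_power)
    then show ?thesis by (simp add: char_std_normal_distribution of_real_exp)
  qed
  moreover have "char (distr M borel (\<lambda>\<omega>. ?S N \<omega> / sqrt (N * (sqrt v)\<^sup>2))) (sqrt v) =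
      expectation (\<lambda>\<omega>. iexp (u \<bullet> normalized_mean W D N \<omega>))" for N
  proof -
    have rv: "random_variable borel (\<lambda>\<omega>. ?S N \<omega> / sqrt (N * (sqrt v)\<^sup>2))"
      using rvX by (intro borel_measurable_divide borel_measurable_sum borel_measurable_const)
    have "sqrt v * (?S N \<omega> / sqrt (N * (sqrt v)\<^sup>2)) = u \<bullet> normalized_mean W D N \<omega>" for \<omega>
    proof -
      have "?S N \<omega> = (\<Sum>n=1..N. u \<bullet> W n \<omega> - u \<bullet> law_mean D)"
        by (rule sum.reindex_bij_witness[of _ "\<lambda>n. n - 1" Suc]) auto
      then show ?thesis using v by (simp add: proj_normalized_mean real_sqrt_mult)
    qed
    then show ?thesis unfolding char_def by (subst integral_distr[OF rv]) simp_all
  qed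
  ultimately show ?thesis by simp
qed

text \<open>The characteristic function of \<open>A *v z\<close> at \<open>t\<close> is that of the
  standard Gaussian at \<open>transpose A *v t\<close>, whose squared norm is the quadratic form of
  \<open>A ** transpose A\<close> at \<open>t\<close>. By \<open>A\<close> this is the variance of
  the projection on \<open>t\<close>; \<open>A\<close> may be singular.\<close>

theorem multivariate_clt:
  assumes A: "\<And>u. (\<integral>w. (u \<bullet> (w - law_mean D))\<^sup>2 \<partial>D) = u \<bullet> ((A ** transpose A) *v u)"
  shows "conv_in_law M (normalized_mean W D) (distr std_multi_normal borel (\<lambda>z. A *v z))"
proof (rule levy_continuity_bounded_second_moments)
  have [measurable]: "(\<lambda>z. A *v z) \<in> borel_measurable borel"
    by (intro borel_measurable_continuous_onI linear_continuous_on) (simp add: matrix_vector_mul_bounded_linear)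
  then have Am: "(\<lambda>z. A *v z) \<in> borel_measurable std_multi_normal" by (simp cong: measurable_cong_sets)
  show "prob_space M" by (rule prob_space_axioms)
  show "prob_space (distr std_multi_normal borel (\<lambda>z. A *v z))"
    by (rule prob_space.prob_space_distr[OF prob_space_std_multi_normal Am])
  show "random_variable borel (normalized_mean W D N)" for N by (rule normalized_mean_measurable)
  show "(\<lambda>N. expectation (\<lambda>\<omega>. iexp (t \<bullet> normalized_mean W D N \<omega>)))
      \<longlonglongrightarrow> (\<integral>y. iexp (t \<bullet> y) \<partial>distr std_multi_normal borel (\<lambda>z. A *v z))" for t
  proof -
    let ?t = "transpose A *v t"
    have adj: "t \<bullet> (A *v z) = ?t \<bullet> z" for z
      by (simp add: dot_lmul_matrix[symmetric])
    have "(\<integral>y. iexp (t \<bullet> y) \<partial>distr std_multi_normal borel (\<lambda>z. A *v z)) =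
        (\<integral>z. iexp (?t \<bullet> z) \<partial>std_multi_normal)"
      by (subst integral_distr[OF Am]) (simp_all add: adj)
    also have "\<dots> = exp (- complex_of_real (t \<bullet> ((A ** transpose A) *v t)) / 2)"
      by (simp add: char_std_multi_normal matrix_vector_mul_assoc[symmetric] adj)
    finally show ?thesis using char_normalized_mean_tendsto[of t] by (simp add: A)
  qed
  \<comment> \<open>The squared norm is a sum of squared projections on the axes, each with a second
    moment that is constant for \<open>N > 0\<close> and 0 for \<open>N = 0\<close>. This gives the
    uniform bound.\<close>
  have nrm: "(norm y)\<^sup>2 = (\<Sum>k\<in>UNIV. (axis k 1 \<bullet> y)\<^sup>2)" for y :: "real ^ 'n"
  proof -
    have "(norm y)\<^sup>2 = (\<Sum>k\<in>UNIV. y $ k * y $ k)"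
      by (simp add: power2_norm_eq_inner inner_vec_def)
    then show ?thesis by (simp add: inner_axis' power2_eq_square)
  qed
  show "integrable M (\<lambda>\<omega>. (norm (normalized_mean W D N \<omega>))\<^sup>2)" for N
    unfolding nrm by (intro Bochner_Integration.integrable_sum proj_normalized_mean_square)
  show "expectation (\<lambda>\<omega>. (norm (normalized_mean W D N \<omega>))\<^sup>2) \<le>
      (\<Sum>k\<in>UNIV. \<integral>w. (axis k 1 \<bullet> (w - law_mean D))\<^sup>2 \<partial>D)" for N
  proof (cases "N = 0")
    case True
    then show ?thesis by (simp add: normalized_mean_def sum_nonneg)
  next
    case False
    then show ?thesis unfolding nrm
      by (subst Bochner_Integration.integral_sum) (simp_all add: proj_normalized_mean_square)
  qed
qed simp

end

end

subsection \<open>Perturbed failure probabilities\<close>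

text \<open>Lets measurability and continuity of pairs be checked coordinate by coordinate.\<close>

lemma vector_2_lambda: "(vector [a, b] :: 'b::zero ^ 2) = (\<chi> k. if k = 1 then a else b)"
  by (simp add: vec_eq_iff forall_2)

lemma continuous_on_vector_2:
  fixes g h :: "'a::topological_space \<Rightarrow> 'b::real_normed_vector"
  assumes "continuous_on S g" "continuous_on S h"
  shows "continuous_on S (\<lambda>x. vector [g x, h x] :: 'b ^ 2)"
  unfolding vector_2_lambda
proof (rule continuous_on_vec_lambda)
  show "continuous_on S (\<lambda>x. if k = 1 then g x else h x)" for k :: 2
    using assms by (cases "k = 1") auto
qed

text \<open>A lower triangular Cholesky factor. Its last entry is the root of the Schur complement
  \<open>c - b\<^sup>2 / a\<close>, the value of the form at \<open>s = - b / a\<close>,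
  \<open>t = 1\<close>.\<close>

lemma psd_factor_2:
  fixes a b c :: real
  assumes psd: "\<And>s t. 0 \<le> a * s\<^sup>2 + 2 * b * s * t + c * t\<^sup>2"
  shows "\<exists>A :: real ^ 2 ^ 2. A ** transpose A = vector [vector [a, b], vector [b, c]]"
proof -
  have a: "0 \<le> a" using psd[of 1 0] by simp
  have b: "b = 0" if "a = 0"
  proof (rule ccontr)
    assume "b \<noteq> 0"
    \<comment> \<open>For \<open>a = 0\<close> the form at \<open>t = 1\<close> is
      \<open>2 * b * s + c\<close>; this \<open>s\<close> makes it -1.\<close>
    then show False using psd[of "- (c + 1) / (2 * b)" 1] that by (simp add: field_simps)
  qed
  \<comment> \<open>For \<open>a = 0\<close> also \<open>b = 0\<close>, and then \<open>b / sqrt a = 0\<close> and \<open>b\<^sup>2 / a = 0\<close> are the right entries.\<close>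
  have d: "0 \<le> c - b\<^sup>2 / a"
    using psd[of "- b / a" 1] by (cases "a = 0") (auto simp: field_simps power2_eq_square b)
  have e: "b * b / a + (c - b\<^sup>2 / a) = c" by (simp add: power2_eq_square)
  have s: "sqrt a * sqrt a = a" "sqrt (c - b\<^sup>2 / a) * sqrt (c - b\<^sup>2 / a) = c - b\<^sup>2 / a"
      "sqrt a * (b / sqrt a) = b" "b / sqrt a * (b / sqrt a) = b * b / a"
    using a b d by auto
  define A :: "real ^ 2 ^ 2" where
    "A = vector [vector [sqrt a, 0], vector [b / sqrt a, sqrt (c - b\<^sup>2 / a)]]"
  have "A ** transpose A = vector [vector [a, b], vector [b, c]]"
    using s e
    by (simp add: A_def vec_eq_iff forall_2 matrix_matrix_mult_def transpose_def sum_2 mult.commute)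
  then show ?thesis by blast
qed

text \<open>The weak law for the images under \<open>g\<close>, which are again independent with a
  common law. It asks only for a first moment, which is what the squared weighted indicator
  has.\<close>

lemma (in prob_space) empirical_mean_conv_in_prob:
  fixes x :: "nat \<Rightarrow> 'a \<Rightarrow> 'b::topological_space" and g :: "'b \<Rightarrow> real"
  assumes indep: "indep_vars (\<lambda>_. borel) x {1..}"
    and X: "random_variable borel X" and distr: "\<And>n. n \<ge> 1 \<Longrightarrow> distr M borel (x n) = distr M borel X"
    and g: "g \<in> borel_measurable borel" and int: "integrable M (\<lambda>\<omega>. g (X \<omega>))"
  shows "conv_in_prob M (\<lambda>N \<omega>. 1 / real N * (\<Sum>n=1..N. g (x n \<omega>))) (expectation (\<lambda>\<omega>. g (X \<omega>)))"
proof -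
  note [measurable] = g X
  let ?D = "distr M borel (\<lambda>\<omega>. g (X \<omega>))"
  have rv [measurable]: "random_variable borel (x n)" if "1 \<le> n" for n
    using indep that by (simp add: indep_vars_def2)
  have iv: "indep_vars (\<lambda>_. borel) (\<lambda>n \<omega>. g (x n \<omega>)) {1..}"
    by (rule indep_vars_compose2[OF indep]) simp
  have d: "distr M borel (\<lambda>\<omega>. g (x n \<omega>)) = ?D" if "1 \<le> n" for n
  proof -
    have "distr (distr M borel (x n)) borel g = distr (distr M borel X) borel g"
      using distr[OF that] by simp
    then show ?thesis using rv[OF that] by (simp add: distr_distr comp_def)
  qed
  have intD: "integrable ?D (\<lambda>t. t)" and ED: "(\<integral>t. t \<partial>?D) = expectation (\<lambda>\<omega>. g (X \<omega>))"
    using int by (simp_all add: integrable_distr_eq integral_distr)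
  have ints: "integrable M (\<lambda>\<omega>. g (x n \<omega>))" if "1 \<le> n" for n
    using integrable_distr[of "\<lambda>\<omega>. g (x n \<omega>)" M borel "\<lambda>t. t"] intD d[OF that]
      measurable_compose[OF rv[OF that] g] by (simp only:)
  show ?thesis
  proof (rule conv_in_prob_of_L1)
    show "integrable M (\<lambda>\<omega>. 1 / real N * (\<Sum>n=1..N. g (x n \<omega>)))" for N
      by (intro integrable_mult_right Bochner_Integration.integrable_sum ints) simp
    show "(\<lambda>N. expectation (\<lambda>\<omega>. \<bar>1 / real N * (\<Sum>n=1..N. g (x n \<omega>)) - expectation (\<lambda>\<omega>. g (X \<omega>))\<bar>)) \<longlonglongrightarrow> 0"
      using weak_law_L1[OF iv d intD] unfolding ED .
  qed
qed

text \<open>Under the density \<open>g\<close> the second moment of the ratio is the integral of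
  \<open>g * (h / g)\<^sup>2\<close>, which is \<open>h\<^sup>2 / g\<close> on \<open>Supp g\<close>
  and 0 elsewhere.\<close>

lemma lik_ratio_square_integrable:
  assumes dist: "distributed M lborel Y (\<lambda>t. ennreal (g t))"
    and g: "is_pdf g" and h: "is_pdf h"
    and fin: "(\<integral>\<^sup>+ t \<in> Supp g. ennreal ((h t)\<^sup>2 / g t) \<partial>lborel) < \<infinity>"
  shows "integrable M (\<lambda>\<omega>. (lik_ratio h g (Y \<omega>))\<^sup>2)"
proof (rule integrableI_nonneg)
  have [measurable]: "g \<in> borel_measurable borel" "h \<in> borel_measurable borel"
    using g h by (auto simp: is_pdf_def)
  have [measurable]: "lik_ratio h g \<in> borel_measurable borel"
    unfolding lik_ratio_def[abs_def] by measurable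
  have [measurable]: "Y \<in> borel_measurable M"
    using distributed_measurable[OF dist] by simp
  show "(\<lambda>\<omega>. (lik_ratio h g (Y \<omega>))\<^sup>2) \<in> borel_measurable M" by measurable
  have "(\<integral>\<^sup>+ \<omega>. ennreal ((lik_ratio h g (Y \<omega>))\<^sup>2) \<partial>M) =
      (\<integral>\<^sup>+ t. ennreal (g t) * ennreal ((lik_ratio h g t)\<^sup>2) \<partial>lborel)"
    by (rule distributed_nn_integral[OF dist, symmetric]) simp
  also have "\<dots> = (\<integral>\<^sup>+ t \<in> Supp g. ennreal ((h t)\<^sup>2 / g t) \<partial>lborel)"
  proof (rule nn_integral_cong)
    fix t
    have "0 \<le> g t" using g by (simp add: is_pdf_def)
    then show "ennreal (g t) * ennreal ((lik_ratio h g t)\<^sup>2) = ennreal ((h t)\<^sup>2 / g t) * indicator (Supp g) t"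
      by (cases "g t = 0")
        (auto simp: Supp_def lik_ratio_def ennreal_mult[symmetric] power2_eq_square indicator_def)
  qed
  finally show "(\<integral>\<^sup>+ \<omega>. ennreal ((lik_ratio h g (Y \<omega>))\<^sup>2) \<partial>M) < \<infinity>" using fin by simp
qed simp

theorem proposition3p1:
  fixes M :: "'a measure"
    and X :: "'a \<Rightarrow> real ^ 'd::finite"
    and x :: "nat \<Rightarrow> 'a \<Rightarrow> real ^ 'd"
    and f :: "'d \<Rightarrow> real \<Rightarrow> real"
    and G :: "real ^ 'd \<Rightarrow> real"
    and i :: 'd
    and f\<delta> :: "real \<Rightarrow> real"
  assumes "prob_space M"
    and "\<And>j. is_pdf (f j)"
    and "\<And>j. distributed M lborel (\<lambda>\<omega>. X \<omega> $ j) (\<lambda>t. ennreal (f j t))"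
    and "prob_space.indep_vars M (\<lambda>_. borel) (\<lambda>j \<omega>. X \<omega> $ j) UNIV"
    and "distributed M lborel X (\<lambda>y. ennreal (joint_pdf f y))"
    and "G \<in> borel_measurable borel"
    and "is_pdf f\<delta>"
    and "prob_space.indep_vars M (\<lambda>_. borel) x {1..}"
    and "\<And>n. n \<ge> 1 \<Longrightarrow> distr M borel (x n) = distr M borel X"
    and "Supp f\<delta> \<subseteq> Supp (f i)"
    and "(\<integral>\<^sup>+ t \<in> Supp (f i). ennreal ((f\<delta> t)\<^sup>2 / f i t) \<partial>lborel) < \<infinity>"
  defines "P \<equiv> P_fail f G"
    and "P\<delta> \<equiv> P_pert f G i f\<delta>"
    and "\<sigma>2 \<equiv> prob_space.variance M (\<lambda>\<omega>. failure G (X \<omega>) * lik_ratio f\<delta> (f i) (X \<omega> $ i))"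
  shows "(\<exists>L :: (real ^ 2) measure. is_multi_normal L 0 (cov_matrix P P\<delta> \<sigma>2) \<and>
            conv_in_law M
              (\<lambda>N \<omega>. sqrt (real N) *\<^sub>R
                 (vector [P_hat G x N \<omega>, P_pert_hat f G i f\<delta> x N \<omega>] - vector [P, P\<delta>])) L)
       \<and> conv_in_prob M
            (\<lambda>N \<omega>. cov_matrix (P_hat G x N \<omega>) (P_pert_hat f G i f\<delta> x N \<omega>) (sigma2_hat f G i f\<delta> x N \<omega>))
            (cov_matrix P P\<delta> \<sigma>2)"
proof -
  interpret prob_space M by fact
  note indep = assms(8) and distr = assms(9)
  \<comment> \<open>The vector of estimators is the empirical mean of
    \<open>w (x n \<omega>)\<close>, with \<open>g\<close> the summand of the weighted
    estimator.\<close>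
  define r where "r = lik_ratio f\<delta> (f i)"
  define g where "g y = failure G y * r (y $ i)" for y
  define w where "w y = (vector [failure G y, g y] :: real ^ 2)" for y
  have [measurable]: "G \<in> borel_measurable borel" "f i \<in> borel_measurable borel" "f\<delta> \<in> borel_measurable borel"
    using assms(2)[of i] assms(6,7) by (auto simp: is_pdf_def)
  have F [measurable]: "failure G \<in> borel_measurable borel"
    unfolding failure_def by measurable
  have r [measurable]: "r \<in> borel_measurable borel"
    unfolding r_def lik_ratio_def[abs_def] by measurable
  have g [measurable]: "g \<in> borel_measurable borel"
    unfolding g_def by measurable
  have w [measurable]: "w \<in> borel_measurable borel"
    unfolding w_def vector_2_lambda by (rule borel_measurable_vec_lambda) simp
  have X [measurable]: "random_variable borel X"
    using distributed_measurable[OF assms(5)] by simp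
  \<comment> \<open>Idempotence of the indicator gives the special form of the covariance matrix
    (\<open>Fsq\<close>, \<open>gF\<close>) and lets \<open>sigma2_hat\<close> be read as an
    empirical second moment of \<open>g\<close> minus a square (\<open>gsq\<close>).\<close>
  have F01: "failure G y = 0 \<or> failure G y = 1" for y by (simp add: failure_def indicator_def)
  then have Fsq: "failure G y * failure G y = failure G y" for y by (metis mult_1 mult_zero_left)
  have gF: "failure G y * g y = g y" for y using Fsq[of y] by (simp add: g_def mult.assoc[symmetric])
  have gsq: "(g y)\<^sup>2 = failure G y * (r (y $ i))\<^sup>2" for y
    using F01[of y] by (auto simp: g_def)
  have r2: "integrable M (\<lambda>\<omega>. (r (X \<omega> $ i))\<^sup>2)"
    unfolding r_def using assms(11) by (intro lik_ratio_square_integrable assms)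
  have g2: "integrable M (\<lambda>\<omega>. (g (X \<omega>))\<^sup>2)"
  proof (rule Bochner_Integration.integrable_bound[OF r2])
    have "norm ((g y)\<^sup>2) \<le> norm ((r (y $ i))\<^sup>2)" for y
      using F01[of y] by (auto simp: g_def)
    then show "AE \<omega> in M. norm ((g (X \<omega>))\<^sup>2) \<le> norm ((r (X \<omega> $ i))\<^sup>2)" by simp
  qed simp
  have g1: "integrable M (\<lambda>\<omega>. g (X \<omega>))"
    by (rule square_integrable_imp_integrable[OF _ g2]) simp
  have F1: "integrable M (\<lambda>\<omega>. failure G (X \<omega>))"
    using F01 by (intro integrable_const_bound[of _ 1]) (auto intro!: AE_I2 simp: failure_def indicator_def)
  have jpdf: "0 \<le> joint_pdf f y" for y
    using assms(2) by (auto simp: joint_pdf_def is_pdf_def intro!: prod_nonneg)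
  \<comment> \<open>The Lebesgue integrals defining \<open>P_fail\<close> and \<open>P_pert\<close>
    become expectations because \<open>X\<close> has density \<open>joint_pdf f\<close>.\<close>
  have EF: "expectation (\<lambda>\<omega>. failure G (X \<omega>)) = P"
    using distributed_integral[OF assms(5), of "failure G"] jpdf
    by (simp add: P_def P_fail_def mult.commute)
  have Eg: "expectation (\<lambda>\<omega>. g (X \<omega>)) = P\<delta>"
    using distributed_integral[OF assms(5), of g] jpdf
    by (simp add: P\<delta>_def P_pert_def g_def r_def mult.commute)
  have \<sigma>2: "\<sigma>2 = expectation (\<lambda>\<omega>. (g (X \<omega>) - P\<delta>)\<^sup>2)"
    unfolding \<sigma>2_def using Eg by (simp add: g_def r_def)
  have \<sigma>2': "\<sigma>2 = expectation (\<lambda>\<omega>. (g (X \<omega>))\<^sup>2) - P\<delta>\<^sup>2"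
    unfolding \<sigma>2 using variance_eq[OF g1 g2] by (simp add: Eg)

  let ?W = "\<lambda>n \<omega>. w (x n \<omega>)"
  let ?D = "distr M borel (\<lambda>\<omega>. w (X \<omega>))"
  have iW: "indep_vars (\<lambda>_. borel) ?W {1..}"
    by (rule indep_vars_compose2[OF indep]) simp
  have dW: "distr M borel (?W n) = ?D" if "1 \<le> n" for n
  proof -
    have "random_variable borel (x n)" using indep that by (simp add: indep_vars_def2)
    moreover have "distr (distr M borel (x n)) borel w = distr (distr M borel X) borel w"
      using distr[OF that] by simp
    ultimately show ?thesis by (simp add: distr_distr comp_def)
  qed
  have w1: "w y $ 1 = failure G y" and w2: "w y $ 2 = g y" for y by (simp_all add: w_def)
  have "(norm (w y))\<^sup>2 = failure G y + (g y)\<^sup>2" for y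
    unfolding power2_norm_eq_inner
    by (simp add: w_def inner_vec_def sum_2 Fsq power2_eq_square)
  then have sqW: "integrable ?D (\<lambda>v. (norm v)\<^sup>2)"
    using F1 g2 by (simp add: integrable_distr_eq)
  note W = iW dW sqW
  have "axis k 1 \<bullet> law_mean ?D = axis k 1 \<bullet> (vector [P, P\<delta>] :: real ^ 2)" for k
  proof -
    have "axis k 1 \<bullet> law_mean ?D = (\<integral>v. axis k 1 \<bullet> v \<partial>?D)"
      by (rule proj_mean[OF W, symmetric])
    also have "\<dots> = expectation (\<lambda>\<omega>. w (X \<omega>) $ k)"
      by (subst integral_distr) (simp_all add: inner_axis')
    also have "\<dots> = vector [P, P\<delta>] $ k"
      using exhaust_2[of k] by (auto simp: w_def EF Eg)
    finally show ?thesis by (simp add: inner_axis')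
  qed
  then have mean: "law_mean ?D = vector [P, P\<delta>]"
    by (simp add: vec_eq_iff inner_axis')
  have cov: "(\<integral>v. (u \<bullet> (v - law_mean ?D))\<^sup>2 \<partial>?D) =
      P * (1 - P) * (u $ 1)\<^sup>2 + 2 * (P\<delta> * (1 - P)) * u $ 1 * u $ 2 + \<sigma>2 * (u $ 2)\<^sup>2" for u
  proof -
    let ?F = "\<lambda>\<omega>. failure G (X \<omega>)" and ?g = "\<lambda>\<omega>. g (X \<omega>)"
    \<comment> \<open>The square is expanded with \<open>failure G y * failure G y\<close> and
      \<open>failure G y * g y\<close> reduced to first-order terms, so their expectations are
      \<open>P\<close> and \<open>P\<delta>\<close>. The coefficients become
      \<open>P * (1 - P)\<close> and \<open>P\<delta> * (1 - P)\<close>.\<close>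
    have "(u \<bullet> (w y - vector [P, P\<delta>]))\<^sup>2 =
        (u $ 1)\<^sup>2 * (failure G y - 2 * P * failure G y + P\<^sup>2) +
        2 * u $ 1 * u $ 2 * (g y - P * g y - P\<delta> * failure G y + P * P\<delta>) +
        (u $ 2)\<^sup>2 * ((g y)\<^sup>2 - 2 * P\<delta> * g y + P\<delta>\<^sup>2)" for y
    proof -
      have "u \<bullet> (w y - vector [P, P\<delta>]) = u $ 1 * (failure G y - P) + u $ 2 * (g y - P\<delta>)"
        by (simp add: inner_vec_def sum_2 w_def)
      also have "\<dots>\<^sup>2 = (u $ 1)\<^sup>2 * (failure G y * failure G y - 2 * P * failure G y + P\<^sup>2) +
        2 * u $ 1 * u $ 2 * (failure G y * g y - P * g y - P\<delta> * failure G y + P * P\<delta>) +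
        (u $ 2)\<^sup>2 * ((g y)\<^sup>2 - 2 * P\<delta> * g y + P\<delta>\<^sup>2)"
        by (simp add: power2_eq_square algebra_simps)
      finally show ?thesis by (simp only: Fsq gF)
    qed
    then have "(\<integral>v. (u \<bullet> (v - law_mean ?D))\<^sup>2 \<partial>?D) =
        (u $ 1)\<^sup>2 * (P - 2 * P * P + P\<^sup>2) + 2 * u $ 1 * u $ 2 * (P\<delta> - P * P\<delta> - P\<delta> * P + P * P\<delta>) +
        (u $ 2)\<^sup>2 * (expectation (\<lambda>\<omega>. (g (X \<omega>))\<^sup>2) - 2 * P\<delta> * P\<delta> + P\<delta>\<^sup>2)"
      using F1 g1 g2 by (simp add: mean integral_distr EF Eg prob_space)
    then show ?thesis by (simp add: \<sigma>2' power2_eq_square algebra_simps)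
  qed
  have quad: "u \<bullet> (cov_matrix P P\<delta> \<sigma>2 *v u) =
      P * (1 - P) * (u $ 1)\<^sup>2 + 2 * (P\<delta> * (1 - P)) * u $ 1 * u $ 2 + \<sigma>2 * (u $ 2)\<^sup>2" for u
    by (simp add: inner_vec_def sum_2 matrix_vector_mult_def cov_matrix_def power2_eq_square algebra_simps)
  \<comment> \<open>The form equals the integral of a square by \<open>cov\<close>, so it is
    nonnegative and the matrix has a factor.\<close>
  have "0 \<le> P * (1 - P) * s\<^sup>2 + 2 * (P\<delta> * (1 - P)) * s * t + \<sigma>2 * t\<^sup>2" for s t
    using cov[of "vector [s, t]", symmetric] by simp
  then obtain A :: "real ^ 2 ^ 2" where A: "A ** transpose A = cov_matrix P P\<delta> \<sigma>2"
    unfolding cov_matrix_def using psd_factor_2 by blast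
  let ?L = "distr std_multi_normal borel (\<lambda>z. A *v z)"
  have "conv_in_law M (normalized_mean ?W ?D) ?L"
    by (rule multivariate_clt[OF W]) (simp_all only: cov A quad)
  moreover have "normalized_mean ?W ?D = (\<lambda>N \<omega>. sqrt (real N) *\<^sub>R
      (vector [P_hat G x N \<omega>, P_pert_hat f G i f\<delta> x N \<omega>] - vector [P, P\<delta>]))"
    by (simp add: fun_eq_iff vec_eq_iff forall_2 normalized_mean_def mean w1 w2 P_hat_def P_pert_hat_def
        g_def r_def)
  moreover have "is_multi_normal ?L 0 (cov_matrix P P\<delta> \<sigma>2)"
    unfolding is_multi_normal_def using A by (intro exI[of _ A]) simp
  moreover have "conv_in_prob M
      (\<lambda>N \<omega>. cov_matrix (P_hat G x N \<omega>) (P_pert_hat f G i f\<delta> x N \<omega>) (sigma2_hat f G i f\<delta> x N \<omega>))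
      (cov_matrix P P\<delta> \<sigma>2)"
  proof -
    \<comment> \<open>The estimated matrix is a continuous function of the empirical means of
      \<open>failure G\<close>, \<open>g\<close> and the square of \<open>g\<close>; at their limits
      it is the true matrix by \<open>\<sigma>2'\<close>.\<close>
    let ?h = "\<lambda>(p, q, m). cov_matrix p q (m - q\<^sup>2)"
    have "conv_in_prob M (\<lambda>N \<omega>. (1 / real N * (\<Sum>n=1..N. failure G (x n \<omega>)),
        1 / real N * (\<Sum>n=1..N. g (x n \<omega>)), 1 / real N * (\<Sum>n=1..N. (g (x n \<omega>))\<^sup>2)))
        (P, P\<delta>, expectation (\<lambda>\<omega>. (g (X \<omega>))\<^sup>2))"
      unfolding EF[symmetric] Eg[symmetric]
      by (intro conv_in_prob_Pair empirical_mean_conv_in_prob[OF indep X distr] F1 g1 g2) auto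
    moreover have "continuous_on UNIV ?h"
      unfolding cov_matrix_def split_beta by (intro continuous_on_vector_2 continuous_intros)
    ultimately have "conv_in_prob M (\<lambda>N \<omega>. ?h (1 / real N * (\<Sum>n=1..N. failure G (x n \<omega>)),
        1 / real N * (\<Sum>n=1..N. g (x n \<omega>)), 1 / real N * (\<Sum>n=1..N. (g (x n \<omega>))\<^sup>2)))
        (?h (P, P\<delta>, expectation (\<lambda>\<omega>. (g (X \<omega>))\<^sup>2)))"
      by (rule conv_in_prob_continuous)
    then show ?thesis
      unfolding gsq unfolding \<sigma>2' gsq
      by (simp add: P_hat_def P_pert_hat_def sigma2_hat_def g_def r_def)
  qed
  ultimately show ?thesis by auto
qed

end
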